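(* Let $m,n\in\mathbb N$, let $\mathbf d=(d_j)_{j=1}^m\in\mathbb N^m$ with $d_1\ge\dots\ge d_m$, and let $\alpha=(\alpha_i)_{i=1}^n\in\mathbb R_{>0}^n$ with $\alpha_1\ge\dots\ge\alpha_n$, such that $d_1\le n$. Let $\mathcal M^{\rm op}=\{\mu_j^{\rm op}\}_{j=1}^m$ be the sequence of vectors associated with $(\alpha,\mathbf d)$ as defined in the context. 1. The pair $(\alpha,\mathcal M^{\rm op})$ is admissible. In particular, there exists $\Phi^{\rm op}=(\mathcal F_j^{\rm op})_{j=1}^m\in\mathcal D(\alpha,\mathbf d)$ such that $\mathcal M_{\Phi^{\rm op}}=\mathcal M^{\rm op}$, i.e. $\lambda(S_{\mathcal F_j^{\rm op}})=\mu_j^{\rm op}$ for every $j\in\{1,\dots,m\}$. 2. For every $\Phi=(\mathcal F_j)_{j=1}^m\in\mathcal D(\alpha,\mathbf d)$ one has $$\Lambda_{\Phi^{\rm op}}\prec\Lambda_\Phi .$$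
   Context: Designs: an $(\alpha,\mathbf d)$-design is an $m$-tuple $\Phi=(\mathcal F_j)_{j=1}^m$ where each $\mathcal F_j=\{f_{ij}\}_{i=1}^n$ is a sequence of $n$ vectors in $\mathbb C^{d_j}$ (not necessarily a frame) and $\sum_{j=1}^m\|f_{ij}\|^2=\alpha_i$ for every $i\in\{1,\dots,n\}$. The set of all $(\alpha,\mathbf d)$-designs is denoted $\mathcal D(\alpha,\mathbf d)$. Frame operator: for a sequence $\mathcal F=\{f_i\}_{i=1}^n$ in $\mathbb C^k$, $S_{\mathcal F}f=\sum_{i=1}^n\langle f,f_i\rangle f_i$ for $f\in\mathbb C^k$. For a selfadjoint $A\in\mathcal M_k(\mathbb C)$, $\lambda(A)\in\mathbb R^k$ is the vector of eigenvalues counted with multiplicity in non-increasing order. For $\Phi=(\mathcal F_j)_{j=1}^m\in\mathcal D(\alpha,\mathbf d)$ put $$\mathcal M_\Phi=\{\lambda(S_{\mathcal F_j})\}_{j=1}^m,\qquad \Lambda_\Phi=(\lambda(S_{\mathcal F_1}),\dots,\lambda(S_{\mathcal F_m}))\in\mathbb R_{\ge0}^{d},\quad d=\sum_{j=1}^m d_j$$ (concatenation, not reordered). Admissibility: for non-increasing vectors $\mu_j\in\mathbb R_{\ge0}^{d_j}$, the pair $(\alpha,\{\mu_j\}_{j=1}^m)$ is admissible if there is $\Phi\in\mathcal D(\alpha,\mathbf d)$ with $\mathcal M_\Phi=\{\mu_j\}_{j=1}^m$. Majorization: for $x,y\in\mathbb R^k$, $x\prec y$ (equivalently $y\succ x$)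 means $\sum_{i=1}^{\ell}x_i^\downarrow\le\sum_{i=1}^{\ell}y_i^\downarrow$ for $1\le\ell\le k$ with equality for $\ell=k$, where $x^\downarrow$ is the non-increasing rearrangement. For non-negative vectors of different lengths, the shorter one is first padded with zeros. Definition of $\mathcal M^{\rm op}$: let $h_i=\#\{j\in\{1,\dots,m\}:d_j\ge i\}$ for $1\le i\le d_1$, and for $1\le s\le t\le d_1$ let $$P_{s,t}=\frac{\sum_{i=s}^t\alpha_i}{\sum_{i=s}^t h_i},\qquad Q_t=\frac{\sum_{i=t}^n\alpha_i}{\sum_{i=t}^{d_1}h_i}.$$ There exist (this is a known fact, for all such $\alpha,\mathbf d$) $p\in\{1,\dots,d_1\}$ and integers $0=g_0<g_1<\dots<g_p=d_1$ such that, with $\gamma_i=P_{g_{i-1}+1,g_i}$ for $1\le i\le p-1$ and $\gamma_p=Q_{g_{p-1}+1}$: (i) $\gamma_1>\dots>\gamma_p>0$; (ii) $(\gamma_i h_k)_{k=g_{i-1}+1}^{g_i}\succ(\alpha_k)_{k=g_{i-1}+1}^{g_i}$ for $1\le i\le p-1$, and $(\gamma_p h_k)_{k=g_{p-1}+1}^{d_1}\succ(\alpha_k)_{k=g_{p-1}+1}^{n}$. Fix any such choice. Then $\mu_1^{\rm op}=(\mu_{i1}^{\rm op})_{i=1}^{d_1}\in\mathbb R_{>0}^{d_1}$ is the vector with $\mu_{i1}^{\rm op}=\gamma_k$ whenever $g_{k-1}+1\le i\le g_k$; for $j>1$, $\mu_j^{\rm op}=(\mu_{i1}^{\rm op})_{i=1}^{d_j}$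 is its truncation to the first $d_j$ entries; and $\mathcal M^{\rm op}=\{\mu_j^{\rm op}\}_{j=1}^m$. *)

theory Defs
  imports Jordan_Normal_Form.Char_Poly
begin

text \<open>Families are functions on natural numbers, indexed from 1, whose values outside the index
  range are irrelevant; vectors in \<open>\<real>\<^sup>k\<close> are lists of length \<open>k\<close>. Coordinates of
  \<^typ>\<open>complex vec\<close> are indexed from 0, as in the library.\<close>

definition segment :: "(nat \<Rightarrow> 'a) \<Rightarrow> nat \<Rightarrow> nat \<Rightarrow> 'a list" where
  "segment x s t = map x [s..<Suc t]"

definition decr :: "real list \<Rightarrow> real list" where
  "decr x = rev (sort x)"

definition zero_pad :: "nat \<Rightarrow> real list \<Rightarrow> real list" where
  "zero_pad k x = x @ replicate (k - length x) 0"

definition majorized :: "real list \<Rightarrow> real list \<Rightarrow> bool" (infix \<open>\<prec>\<^sub>m\<close> 50) where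
  "x \<prec>\<^sub>m y \<longleftrightarrow>
    (let k = max (length x) (length y); x' = decr (zero_pad k x); y' = decr (zero_pad k y)
     in (\<forall>l\<in>{1..k}. (\<Sum>i<l. x' ! i) \<le> (\<Sum>i<l. y' ! i)) \<and> (\<Sum>i<k. x' ! i) = (\<Sum>i<k. y' ! i))"

definition cvec_norm :: "complex vec \<Rightarrow> real" where
  "cvec_norm v = sqrt (Re (v \<bullet>c v))"

definition frame_op :: "nat \<Rightarrow> nat \<Rightarrow> (nat \<Rightarrow> complex vec) \<Rightarrow> complex vec \<Rightarrow> complex vec" where
  "frame_op k n F v = finsum_vec TYPE(complex) k (\<lambda>i. (v \<bullet>c F i) \<cdot>\<^sub>v F i) {1..n}"

definition frame_mat :: "nat \<Rightarrow> nat \<Rightarrow> (nat \<Rightarrow> complex vec) \<Rightarrow> complex mat" where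
  "frame_mat k n F = mat k k (\<lambda>(a, b). frame_op k n F (unit_vec k b) $ a)"

lemma frame_op_index:
  assumes "\<And>i. i \<in> {1..n} \<Longrightarrow> F i \<in> carrier_vec k" and "a < k"
  shows "frame_op k n F v $ a = (\<Sum>i=1..n. (v \<bullet>c F i) * F i $ a)"
proof -
  have "frame_op k n F v $ a = (\<Sum>i\<in>{1..n}. ((v \<bullet>c F i) \<cdot>\<^sub>v F i) $ a)"
    unfolding frame_op_def by (rule index_finsum_vec) (use assms in auto)
  also have "\<dots> = (\<Sum>i=1..n. (v \<bullet>c F i) * F i $ a)"
  proof (rule sum.cong)
    fix i assume "i \<in> {1..n}"
    then have "a < dim_vec (F i)" using assms by (metis carrier_vecD)
    then show "((v \<bullet>c F i) \<cdot>\<^sub>v F i) $ a = (v \<bullet>c F i) * F i $ a" by simp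
  qed simp
  finally show ?thesis .
qed

lemma frame_mat_mult_vec:
  assumes F: "\<And>i. i \<in> {1..n} \<Longrightarrow> F i \<in> carrier_vec k" and v: "v \<in> carrier_vec k"
  shows "frame_mat k n F *\<^sub>v v = frame_op k n F v"
proof (rule eq_vecI)
  have c: "frame_op k n F v \<in> carrier_vec k"
    unfolding frame_op_def by (rule finsum_vec_closed) (use F in auto)
  show "dim_vec (frame_mat k n F *\<^sub>v v) = dim_vec (frame_op k n F v)"
    using c by (simp add: frame_mat_def)
  fix a assume "a < dim_vec (frame_op k n F v)"
  with c have a: "a < k" by simp
  have idx: "frame_op k n F x $ a = (\<Sum>i=1..n. (x \<bullet>c F i) * F i $ a)" for x
    using F a by (rule frame_op_index)
  have u: "unit_vec k b \<bullet>c F i = cnj (F i $ b)" if "b < k" "i \<in> {1..n}" for b i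
    using F[OF that(2)] that(1) by (simp add: scalar_prod_left_unit)
  have w: "v \<bullet>c F i = (\<Sum>b<k. v $ b * cnj (F i $ b))" if "i \<in> {1..n}" for i
    using F[OF that] by (auto simp: scalar_prod_def atLeast0LessThan intro!: sum.cong)
  have "(frame_mat k n F *\<^sub>v v) $ a = (\<Sum>b<k. frame_op k n F (unit_vec k b) $ a * v $ b)"
    using a v by (auto simp: frame_mat_def scalar_prod_def atLeast0LessThan intro!: sum.cong)
  also have "\<dots> = (\<Sum>b<k. \<Sum>i=1..n. cnj (F i $ b) * F i $ a * v $ b)"
  proof (rule sum.cong)
    fix b assume "b \<in> {..<k}"
    then have b: "b < k" by simp
    show "frame_op k n F (unit_vec k b) $ a * v $ b = (\<Sum>i=1..n. cnj (F i $ b) * F i $ a * v $ b)"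
      unfolding idx sum_distrib_right
      by (rule sum.cong) (simp_all only: u[OF b])
  qed simp
  also have "\<dots> = (\<Sum>i=1..n. \<Sum>b<k. cnj (F i $ b) * F i $ a * v $ b)"
    by (rule sum.swap)
  also have "\<dots> = frame_op k n F v $ a"
    unfolding idx using w
    by (intro sum.cong refl) (simp add: sum_distrib_right sum_distrib_left mult_ac)
  finally show "(frame_mat k n F *\<^sub>v v) $ a = frame_op k n F v $ a" .
qed

text \<open>Only used for selfadjoint matrices: their eigenvalues are real, so \<^const>\<open>Re\<close> is just the
  coercion to \<^typ>\<open>real\<close>, and algebraic and geometric multiplicities agree.\<close>

definition spectrum_decr :: "complex mat \<Rightarrow> real list" where
  "spectrum_decr A = rev (sorted_list_of_multiset (image_mset Re (proots (char_poly A))))"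

text \<open>\<open>\<Phi> j i\<close> is the vector \<open>f\<^sub>i\<^sub>j\<close>.\<close>

definition designs ::
  "nat \<Rightarrow> nat \<Rightarrow> (nat \<Rightarrow> real) \<Rightarrow> (nat \<Rightarrow> nat) \<Rightarrow> (nat \<Rightarrow> nat \<Rightarrow> complex vec) set" where
  "designs m n \<alpha> d = {\<Phi>.
     (\<forall>j\<in>{1..m}. \<forall>i\<in>{1..n}. \<Phi> j i \<in> carrier_vec (d j)) \<and>
     (\<forall>i\<in>{1..n}. (\<Sum>j=1..m. (cvec_norm (\<Phi> j i))\<^sup>2) = \<alpha> i)}"

definition design_spectra ::
  "nat \<Rightarrow> nat \<Rightarrow> (nat \<Rightarrow> nat) \<Rightarrow> (nat \<Rightarrow> nat \<Rightarrow> complex vec) \<Rightarrow> real list list" where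
  "design_spectra m n d \<Phi> = segment (\<lambda>j. spectrum_decr (frame_mat (d j) n (\<Phi> j))) 1 m"

definition design_Lambda ::
  "nat \<Rightarrow> nat \<Rightarrow> (nat \<Rightarrow> nat) \<Rightarrow> (nat \<Rightarrow> nat \<Rightarrow> complex vec) \<Rightarrow> real list" where
  "design_Lambda m n d \<Phi> = concat (design_spectra m n d \<Phi>)"

definition admissible ::
  "nat \<Rightarrow> nat \<Rightarrow> (nat \<Rightarrow> real) \<Rightarrow> (nat \<Rightarrow> nat) \<Rightarrow> (nat \<Rightarrow> real list) \<Rightarrow> bool" where
  "admissible m n \<alpha> d \<mu> \<longleftrightarrow>
     (\<forall>j\<in>{1..m}. length (\<mu> j) = d j \<and> sorted_wrt (\<ge>) (\<mu> j) \<and> (\<forall>x\<in>set (\<mu> j). 0 \<le> x)) \<and>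
     (\<exists>\<Phi>\<in>designs m n \<alpha> d. design_spectra m n d \<Phi> = segment \<mu> 1 m)"

definition h_count :: "nat \<Rightarrow> (nat \<Rightarrow> nat) \<Rightarrow> nat \<Rightarrow> nat" where
  "h_count m d i = card {j \<in> {1..m}. i \<le> d j}"

definition P_avg :: "nat \<Rightarrow> (nat \<Rightarrow> real) \<Rightarrow> (nat \<Rightarrow> nat) \<Rightarrow> nat \<Rightarrow> nat \<Rightarrow> real" where
  "P_avg m \<alpha> d s t = (\<Sum>i=s..t. \<alpha> i) / (\<Sum>i=s..t. real (h_count m d i))"

definition Q_avg :: "nat \<Rightarrow> nat \<Rightarrow> (nat \<Rightarrow> real) \<Rightarrow> (nat \<Rightarrow> nat) \<Rightarrow> nat \<Rightarrow> real" where
  "Q_avg m n \<alpha> d t = (\<Sum>i=t..n. \<alpha> i) / (\<Sum>i=t..d 1. real (h_count m d i))"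

definition op_gamma ::
  "nat \<Rightarrow> nat \<Rightarrow> (nat \<Rightarrow> real) \<Rightarrow> (nat \<Rightarrow> nat) \<Rightarrow> nat \<Rightarrow> (nat \<Rightarrow> nat) \<Rightarrow> nat \<Rightarrow> real" where
  "op_gamma m n \<alpha> d p g i =
     (if i < p then P_avg m \<alpha> d (g (i - 1) + 1) (g i) else Q_avg m n \<alpha> d (g (p - 1) + 1))"

definition op_partition ::
  "nat \<Rightarrow> nat \<Rightarrow> (nat \<Rightarrow> real) \<Rightarrow> (nat \<Rightarrow> nat) \<Rightarrow> nat \<Rightarrow> (nat \<Rightarrow> nat) \<Rightarrow> bool" where
  "op_partition m n \<alpha> d p g \<longleftrightarrow>
     p \<in> {1..d 1} \<and> g 0 = 0 \<and> g p = d 1 \<and> (\<forall>i\<in>{1..p}. g (i - 1) < g i) \<and>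
     (let \<gamma> = op_gamma m n \<alpha> d p g; h = (\<lambda>k. real (h_count m d k)) in
       (\<forall>i\<in>{1..<p}. \<gamma> i > \<gamma> (i + 1)) \<and> \<gamma> p > 0 \<and>
       (\<forall>i\<in>{1..<p}. segment \<alpha> (g (i - 1) + 1) (g i)
          \<prec>\<^sub>m segment (\<lambda>k. \<gamma> i * h k) (g (i - 1) + 1) (g i)) \<and>
       segment \<alpha> (g (p - 1) + 1) n \<prec>\<^sub>m segment (\<lambda>k. \<gamma> p * h k) (g (p - 1) + 1) (d 1))"

definition op_mu1 ::
  "nat \<Rightarrow> nat \<Rightarrow> (nat \<Rightarrow> real) \<Rightarrow> (nat \<Rightarrow> nat) \<Rightarrow> nat \<Rightarrow> (nat \<Rightarrow> nat) \<Rightarrow> nat \<Rightarrow> real" where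
  "op_mu1 m n \<alpha> d p g i =
     op_gamma m n \<alpha> d p g (THE k. k \<in> {1..p} \<and> g (k - 1) + 1 \<le> i \<and> i \<le> g k)"

definition op_mu ::
  "nat \<Rightarrow> nat \<Rightarrow> (nat \<Rightarrow> real) \<Rightarrow> (nat \<Rightarrow> nat) \<Rightarrow> nat \<Rightarrow> (nat \<Rightarrow> nat) \<Rightarrow> nat \<Rightarrow> real list" where
  "op_mu m n \<alpha> d p g j = segment (op_mu1 m n \<alpha> d p g) 1 (d j)"

end

theory Submission
  imports
    Defs
    Jordan_Normal_Form.Schur_Decomposition
    "HOL-Computational_Algebra.Fundamental_Theorem_Algebra"
begin

text \<open>
  Write \<open>\<mu>\<^sub>i\<close> for the entries of \<open>\<mu>\<^sub>1\<^sup>o\<^sup>p\<close> and \<open>h\<^sub>i\<close> for the number of spaces that have an \<open>i\<close>-th coordinate.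

  Existence. Since \<open>\<mu>\<close> and \<open>h\<close> are both non-increasing, so is \<open>i \<mapsto> \<mu>\<^sub>i h\<^sub>i\<close>; gluing the majorizations
  of the blocks therefore gives that \<open>\<alpha>\<close> is majorized by \<open>(\<mu>\<^sub>i h\<^sub>i)\<close>, padded with zeros to length
  \<open>n\<close>. By Horn's theorem (\<open>horn_orthogonal\<close>) some real orthogonal \<open>U\<close> satisfies
  \<open>\<alpha>\<^sub>s = \<Sum>\<^sub>i U\<^sub>s\<^sub>i\<^sup>2 \<mu>\<^sub>i h\<^sub>i\<close>. The single matrix \<open>U\<close> serves all spaces at once: let the \<open>i\<close>-th coordinate of
  \<open>f\<^sub>s\<^sub>j\<close> be \<open>\<surd>\<mu>\<^sub>i U\<^sub>s\<^sub>i\<close> for every \<open>i \<le> d\<^sub>j\<close>. Orthogonality of the columns of \<open>U\<close> makes the \<open>j\<close>-th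
  frame operator the diagonal matrix with entries \<open>\<mu>\<^sub>i\<close>, and in \<open>\<Sum>\<^sub>j \<parallel>f\<^sub>s\<^sub>j\<parallel>\<^sup>2\<close> the term \<open>\<mu>\<^sub>i U\<^sub>s\<^sub>i\<^sup>2\<close>
  occurs exactly \<open>h\<^sub>i\<close> times, so that the sum is \<open>\<alpha>\<^sub>s\<close>.

  Optimality. For vectors of equal length and equal sum, \<open>x \<prec> y\<close> follows from
  \<open>\<Sum> (x\<^sub>i - t)\<^sup>+ \<le> \<Sum> (y\<^sub>i - t)\<^sup>+\<close> for all \<open>t\<close> (\<open>majorized_if_hinge_le\<close>). The total \<open>\<Sum> \<alpha>\<^sub>s\<close> is
  the sum of the traces of the frame operators of every design. If \<open>t\<close> is below every \<open>\<mu>\<^sub>i\<close>, the optimal spectra attain the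
  lower bound \<open>\<Sum> (x\<^sub>i - t)\<close>. Otherwise \<open>t \<ge> \<gamma>\<^sub>p > 0\<close>, and the \<open>\<mu>\<^sub>i\<close> above \<open>t\<close> are those of the first \<open>r\<close> blocks, with
  \<open>r < p\<close>; put \<open>S = {1..g\<^sub>r}\<close>. On these blocks \<open>\<Sum> \<mu>\<^sub>i h\<^sub>i = \<Sum>\<^sub>S \<alpha>\<^sub>s\<close>, so the optimal value is
  \<open>\<Sum>\<^sub>S \<alpha>\<^sub>s - t \<Sum>\<^sub>j min (card S) d\<^sub>j\<close>. No design does better: in the \<open>j\<close>-th space the vectors indexed by
  \<open>S\<close> contribute to the frame operator a part of rank at most \<open>min (card S) d\<^sub>j\<close> and of trace
  \<open>\<Sum>\<^sub>S \<parallel>f\<^sub>s\<^sub>j\<parallel>\<^sup>2\<close>, which is bounded by the hinge sum of the spectrum plus \<open>t\<close> times that rank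
  (\<open>frame_spectrum_hinge\<close>).
\<close>

section \<open>A threshold criterion for majorization\<close>

lemma decr_eq_self: "sorted_wrt (\<ge>) x \<Longrightarrow> decr x = x"
proof -
  assume "sorted_wrt (\<ge>) x"
  then have "sorted (rev x)" by (simp add: sorted_wrt_rev)
  then have "sort x = rev x" by (metis mset_rev properties_for_sort)
  then show ?thesis by (simp add: decr_def)
qed

lemma mset_decr [simp]: "mset (decr x) = mset x"
  by (simp add: decr_def)

lemma length_decr [simp]: "length (decr x) = length x"
  by (simp add: decr_def)

lemma decr_nth_antimono:
  assumes "i \<le> j" "j < length x"
  shows "decr x ! j \<le> decr x ! i"
proof -
  have "sorted (sort x)" by simp
  then show ?thesis
    using assms unfolding decr_def
    by (auto simp: rev_nth intro!: sorted_nth_mono)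
qed

lemma zero_pad_self [simp]: "zero_pad (length x) x = x"
  by (simp add: zero_pad_def)

lemma sum_nth_decr:
  fixes \<phi> :: "real \<Rightarrow> real"
  shows "(\<Sum>i<length x. \<phi> (decr x ! i)) = sum_list (map \<phi> x)"
proof -
  have "(\<Sum>i<length x. \<phi> (decr x ! i)) = sum_list (map \<phi> (decr x))"
    by (simp add: sum_list_sum_nth atLeast0LessThan)
  also have "\<dots> = sum_mset (image_mset \<phi> (mset (decr x)))"
    by (metis mset_map sum_mset_sum_list)
  also have "\<dots> = sum_list (map \<phi> x)"
    by (metis mset_decr mset_map sum_mset_sum_list)
  finally show ?thesis .
qed

text \<open>The sum of the \<open>l\<close> largest entries of \<open>x\<close> is at most \<open>l t + \<Sum> (x\<^sub>i - t)\<^sup>+\<close> for every \<open>t\<close>, and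
  for \<open>y\<close> equality holds when \<open>t\<close> is its \<open>l\<close>-th largest entry. This replaces the comparison of sorted
  vectors by one of sums that do not depend on the order of the entries.\<close>

lemma majorized_if_hinge_le:
  assumes len: "length x = length y"
    and tot: "sum_list x = sum_list y"
    and hinge: "\<And>t. (\<Sum>a\<leftarrow>x. max 0 (a - t)) \<le> (\<Sum>a\<leftarrow>y. max 0 (a - t))"
  shows "x \<prec>\<^sub>m y"
proof -
  let ?k = "length x" and ?x = "decr x" and ?y = "decr y"
  have "(\<Sum>i<l. ?x ! i) \<le> (\<Sum>i<l. ?y ! i)" if l: "1 \<le> l" "l \<le> ?k" for l
  proof -
    define t where "t = ?y ! (l - 1)"
    have "(\<Sum>i<l. ?x ! i) - real l * t = (\<Sum>i<l. ?x ! i - t)"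
      by (simp add: sum_subtractf)
    also have "\<dots> \<le> (\<Sum>i<l. max 0 (?x ! i - t))"
      by (rule sum_mono) simp
    also have "\<dots> \<le> (\<Sum>i<?k. max 0 (?x ! i - t))"
      by (rule sum_mono2) (use l in auto)
    also have "\<dots> = (\<Sum>a\<leftarrow>x. max 0 (a - t))"
      by (rule sum_nth_decr)
    also have "\<dots> \<le> (\<Sum>a\<leftarrow>y. max 0 (a - t))"
      by (rule hinge)
    also have "\<dots> = (\<Sum>i<?k. max 0 (?y ! i - t))"
      using sum_nth_decr[of "\<lambda>a. max 0 (a - t)" y] len by simp
    also have "\<dots> = (\<Sum>i<l. max 0 (?y ! i - t))"
    proof (rule sum.mono_neutral_right)
      show "\<forall>i\<in>{..<?k} - {..<l}. max 0 (?y ! i - t) = 0"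
      proof
        fix i assume "i \<in> {..<?k} - {..<l}"
        then have "?y ! i \<le> t"
          unfolding t_def by (intro decr_nth_antimono) (use len in auto)
        then show "max 0 (?y ! i - t) = 0" by simp
      qed
    qed (use l in auto)
    also have "\<dots> = (\<Sum>i<l. ?y ! i - t)"
    proof (rule sum.cong)
      fix i assume "i \<in> {..<l}"
      then have "t \<le> ?y ! i"
        unfolding t_def by (intro decr_nth_antimono) (use l len in auto)
      then show "max 0 (?y ! i - t) = ?y ! i - t" by simp
    qed simp
    also have "\<dots> = (\<Sum>i<l. ?y ! i) - real l * t"
      by (simp add: sum_subtractf)
    finally show ?thesis by simp
  qed
  moreover have "(\<Sum>i<?k. ?x ! i) = (\<Sum>i<?k. ?y ! i)"
    using sum_nth_decr[of "\<lambda>a. a" x] sum_nth_decr[of "\<lambda>a. a" y] tot len by simp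
  ultimately show ?thesis
    using len zero_pad_self[of x] zero_pad_self[of y]
    by (auto simp: majorized_def Let_def simp del: zero_pad_self)
qed

section \<open>Horn's theorem\<close>

lemma sum_lessThan_Suc_skip:
  fixes f :: "nat \<Rightarrow> 'a :: comm_monoid_add"
  assumes "k < N"
  shows "(\<Sum>i<Suc N. f i) = f (Suc k) + (\<Sum>i<N. f (if i \<le> k then i else Suc i))"
  using assms
proof (induction N)
  case (Suc N)
  show ?case
  proof (cases "k = N")
    case True
    have "(\<Sum>i<Suc N. f (if i \<le> k then i else Suc i)) = (\<Sum>i<Suc N. f i)"
      by (rule sum.cong) (use True in auto)
    then show ?thesis using True by (simp add: ac_simps)
  next
    case False
    with Suc have "k < N" by simp
    with Suc.IH have "(\<Sum>i<Suc N. f i) = f (Suc k) + (\<Sum>i<N. f (if i \<le> k then i else Suc i))" .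
    then have "(\<Sum>i<Suc (Suc N). f i) =
        f (Suc k) + (\<Sum>i<N. f (if i \<le> k then i else Suc i)) + f (Suc N)"
      by (simp only: sum.lessThan_Suc[of f "Suc N"])
    also have "\<dots> = f (Suc k) + (\<Sum>i<Suc N. f (if i \<le> k then i else Suc i))"
      using \<open>k < N\<close> by (simp add: ac_simps)
    finally show ?thesis .
  qed
qed simp

text \<open>With \<open>c\<close> and \<open>s\<close> as the cosine and sine of a plane rotation, \<open>x\<close> is the diagonal entry obtained
  by conjugating the diagonal matrix with entries \<open>u\<close>, \<open>v\<close>.\<close>

lemma convex_combination_by_rotation:
  fixes u v x :: real
  assumes "v \<le> x" "x \<le> u"
  obtains c s where "c\<^sup>2 + s\<^sup>2 = 1" "c\<^sup>2 * u + s\<^sup>2 * v = x"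
proof (cases "u = v")
  case True
  then show ?thesis using that[of 1 0] assms by simp
next
  case False
  then have uv: "v < u" using assms by simp
  define c where "c = sqrt ((x - v) / (u - v))"
  define s where "s = sqrt ((u - x) / (u - v))"
  have c2: "c\<^sup>2 = (x - v) / (u - v)" and s2: "s\<^sup>2 = (u - x) / (u - v)"
    using assms uv by (simp_all add: c_def s_def)
  show ?thesis
  proof (rule that)
    show "c\<^sup>2 + s\<^sup>2 = 1"
      unfolding c2 s2 using uv by (simp add: add_divide_distrib[symmetric])
    have "c\<^sup>2 * u + s\<^sup>2 * v = ((x - v) * u + (u - x) * v) / (u - v)"
      unfolding c2 s2 by (simp add: add_divide_distrib)
    also have "(x - v) * u + (u - x) * v = x * (u - v)"
      by (simp add: algebra_simps)
    finally show "c\<^sup>2 * u + s\<^sup>2 * v = x" using uv by simp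
  qed
qed

text \<open>Horn's half of the Schur-Horn theorem: \<open>\<alpha>\<close> is the diagonal of \<open>U diag(\<beta>) U\<^sup>T\<close>. Induction on \<open>n\<close>:
  choose neighbours \<open>\<beta>\<^sub>k \<ge> \<alpha>\<^sub>0 \<ge> \<beta>\<^sub>k\<^sub>+\<^sub>1\<close> and rotate in their plane, so that one of the two diagonal
  entries becomes \<open>\<alpha>\<^sub>0\<close> and the other \<open>\<beta>\<^sub>k + \<beta>\<^sub>k\<^sub>+\<^sub>1 - \<alpha>\<^sub>0\<close>. The latter again lies between \<open>\<beta>\<^sub>k\<close> and
  \<open>\<beta>\<^sub>k\<^sub>+\<^sub>1\<close>, so the \<open>n - 1\<close> remaining entries are still sorted and still majorize \<open>\<alpha>\<^sub>1, \<dots>\<close>. An orthogonal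
  change of basis inside the remaining \<open>n - 1\<close> directions does not affect the row that realizes \<open>\<alpha>\<^sub>0\<close>.\<close>

theorem horn_orthogonal:
  fixes \<alpha> \<beta> :: "nat \<Rightarrow> real"
  assumes "\<And>i j. i \<le> j \<Longrightarrow> j < n \<Longrightarrow> \<alpha> j \<le> \<alpha> i"
    and "\<And>i j. i \<le> j \<Longrightarrow> j < n \<Longrightarrow> \<beta> j \<le> \<beta> i"
    and "\<And>l. l \<le> n \<Longrightarrow> (\<Sum>i<l. \<alpha> i) \<le> (\<Sum>i<l. \<beta> i)"
    and "(\<Sum>i<n. \<alpha> i) = (\<Sum>i<n. \<beta> i)"
  shows "\<exists>U :: nat \<Rightarrow> nat \<Rightarrow> real.
      (\<forall>i<n. \<forall>j<n. (\<Sum>a<n. U a i * U a j) = (if i = j then 1 else 0)) \<and>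
      (\<forall>a<n. (\<Sum>i<n. (U a i)\<^sup>2 * \<beta> i) = \<alpha> a)"
  using assms
proof (induction n arbitrary: \<alpha> \<beta>)
  case 0
  show ?case by simp
next
  case (Suc N)
  note \<alpha>_dec = Suc.prems(1) and \<beta>_dec = Suc.prems(2) and partial = Suc.prems(3)
    and total = Suc.prems(4)
  show ?case
  proof (cases "N = 0")
    case True
    then show ?thesis using total by (intro exI[of _ "\<lambda>_ _. 1"]) simp
  next
    case False
    have first: "\<alpha> 0 \<le> \<beta> 0" using partial[of 1] by simp
    have last: "\<beta> N \<le> \<alpha> 0"
      using partial[of N] total \<alpha>_dec[of 0 N] by simp
    \<comment> \<open>Equality of the totals forces the last \<open>\<beta>\<close> below the last \<open>\<alpha>\<close>, so the values of \<open>\<beta>\<close> cross \<open>\<alpha>\<^sub>0\<close>.\<close>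
    define k where "k = Max {i. i < N \<and> \<alpha> 0 \<le> \<beta> i}"
    have k_in: "k \<in> {i. i < N \<and> \<alpha> 0 \<le> \<beta> i}"
      unfolding k_def by (rule Max_in) (use False first in auto)
    then have k: "k < N" and \<beta>k: "\<alpha> 0 \<le> \<beta> k" by auto
    have \<beta>k1: "\<beta> (Suc k) \<le> \<alpha> 0"
    proof (cases "Suc k = N")
      case False
      have "i \<le> k" if "i \<in> {i. i < N \<and> \<alpha> 0 \<le> \<beta> i}" for i
        unfolding k_def by (rule Max_ge) (use that in auto)
      then have "Suc k \<notin> {i. i < N \<and> \<alpha> 0 \<le> \<beta> i}" by fastforce
      then show ?thesis using False k by auto
    qed (use last in simp)
    obtain c s where cs: "c\<^sup>2 + s\<^sup>2 = 1" "c\<^sup>2 * \<beta> k + s\<^sup>2 * \<beta> (Suc k) = \<alpha> 0"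
      using convex_combination_by_rotation[OF \<beta>k1 \<beta>k] .
    define \<mu> where "\<mu> i = (if i < k then \<beta> i
        else if i = k then \<beta> k + \<beta> (Suc k) - \<alpha> 0 else \<beta> (Suc i))" for i
    have \<mu>_sum: "(\<Sum>i<l. \<mu> i) = (if l \<le> k then \<Sum>i<l. \<beta> i else (\<Sum>i<Suc l. \<beta> i) - \<alpha> 0)" for l
      by (induction l) (auto simp: \<mu>_def not_le less_Suc_eq)
    have \<alpha>_sum: "(\<Sum>i<l. \<alpha> (Suc i)) = (\<Sum>i<Suc l. \<alpha> i) - \<alpha> 0" for l
      by (simp add: sum.lessThan_Suc_shift del: sum.lessThan_Suc)
    have "\<exists>V :: nat \<Rightarrow> nat \<Rightarrow> real.
      (\<forall>i<N. \<forall>j<N. (\<Sum>a<N. V a i * V a j) = (if i = j then 1 else 0)) \<and>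
      (\<forall>a<N. (\<Sum>i<N. (V a i)\<^sup>2 * \<mu> i) = \<alpha> (Suc a))"
    proof (rule Suc.IH)
      show "\<alpha> (Suc j) \<le> \<alpha> (Suc i)" if "i \<le> j" "j < N" for i j
        using that by (intro \<alpha>_dec) auto
      show "\<mu> j \<le> \<mu> i" if ij: "i \<le> j" "j < N" for i j
      proof -
        consider "j < k" | "j = k" "i = k" | "j = k" "i < k" | "k < j" "i < k"
          | "k < j" "i = k" | "k < i" using ij(1) by linarith
        then show ?thesis
        proof cases
          case 1 then show ?thesis using \<beta>_dec[of i j] ij by (simp add: \<mu>_def)
        next
          case 2 then show ?thesis by simp
        next
          case 3 then show ?thesis using \<beta>_dec[of i k] \<beta>k1 k by (simp add: \<mu>_def)
        next
          case 4 then show ?thesis using \<beta>_dec[of i "Suc j"] ij by (simp add: \<mu>_def)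
        next
          case 5 then show ?thesis using \<beta>_dec[of "Suc k" "Suc j"] \<beta>k ij by (simp add: \<mu>_def)
        next
          case 6 then show ?thesis using \<beta>_dec[of "Suc i" "Suc j"] ij by (simp add: \<mu>_def)
        qed
      qed
      show "(\<Sum>i<l. \<alpha> (Suc i)) \<le> (\<Sum>i<l. \<mu> i)" if l: "l \<le> N" for l
      proof (cases "l \<le> k")
        case True
        have "\<alpha> (Suc i) \<le> \<beta> i" if "i < l" for i
          using \<alpha>_dec[of 0 "Suc i"] \<beta>_dec[of i k] \<beta>k that True k l by simp
        then show ?thesis
          using True unfolding \<mu>_sum by (auto intro!: sum_mono)
      next
        case False
        then show ?thesis
          using partial[of "Suc l"] l by (simp only: \<mu>_sum \<alpha>_sum) simp
      qed
      show "(\<Sum>i<N. \<alpha> (Suc i)) = (\<Sum>i<N. \<mu> i)"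
        using k total by (simp only: \<mu>_sum \<alpha>_sum) simp
    qed
    then obtain V :: "nat \<Rightarrow> nat \<Rightarrow> real" where
      V_orth: "\<And>i j. i < N \<Longrightarrow> j < N \<Longrightarrow> (\<Sum>a<N. V a i * V a j) = (if i = j then 1 else 0)"
      and V_diag: "\<And>a. a < N \<Longrightarrow> (\<Sum>i<N. (V a i)\<^sup>2 * \<mu> i) = \<alpha> (Suc a)"
      by blast
    \<comment> \<open>Row 0 of \<open>U\<close> is the unit vector \<open>c e\<^sub>k + s e\<^sub>k\<^sub>+\<^sub>1\<close>. The other rows expand the rows of \<open>V\<close> in the basis
      of its orthogonal complement formed by \<open>- s e\<^sub>k + c e\<^sub>k\<^sub>+\<^sub>1\<close> and the other unit vectors; \<open>\<sigma>\<close> sends a coordinate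
      to the index of the basis vector supported there and \<open>w\<close> is its coefficient.\<close>
    define r where "r i = (if i = k then c else if i = Suc k then s else 0)" for i
    define w where "w i = (if i = k then - s else if i = Suc k then c else 1)" for i
    define \<sigma> where "\<sigma> i = (if i \<le> k then i else i - 1)" for i :: nat
    define U where "U a i = (case a of 0 \<Rightarrow> r i | Suc b \<Rightarrow> w i * V b (\<sigma> i))" for a i
    have \<sigma>: "\<sigma> i < N" if "i < Suc N" for i using that k by (auto simp: \<sigma>_def)
    have "(\<Sum>a<Suc N. U a i * U a j) = (if i = j then 1 else 0)" if ij: "i < Suc N" "j < Suc N" for i j
    proof -
      have "(\<Sum>a<Suc N. U a i * U a j) = r i * r j + (\<Sum>b<N. (w i * V b (\<sigma> i)) * (w j * V b (\<sigma> j)))"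
        by (simp only: sum.lessThan_Suc_shift) (simp add: U_def)
      also have "(\<Sum>b<N. (w i * V b (\<sigma> i)) * (w j * V b (\<sigma> j))) =
          w i * w j * (\<Sum>b<N. V b (\<sigma> i) * V b (\<sigma> j))"
        by (simp add: sum_distrib_left mult_ac)
      also have "\<dots> = w i * w j * (if \<sigma> i = \<sigma> j then 1 else 0)"
        using V_orth[OF \<sigma> \<sigma>] ij by simp
      also have "r i * r j + \<dots> = (if i = j then 1 else 0)"
        using cs(1) unfolding r_def w_def \<sigma>_def by (auto simp: power2_eq_square add.commute)
      finally show ?thesis .
    qed
    moreover have "(\<Sum>i<Suc N. (U a i)\<^sup>2 * \<beta> i) = \<alpha> a" if a: "a < Suc N" for a
    proof (cases a)
      case 0
      have "(\<Sum>i<Suc N. (U a i)\<^sup>2 * \<beta> i) = (\<Sum>i\<in>{k, Suc k}. (r i)\<^sup>2 * \<beta> i)"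
        unfolding U_def 0 by (simp only: nat.case) (rule sum.mono_neutral_right, use k in \<open>auto simp: r_def\<close>)
      also have "\<dots> = \<alpha> 0" using cs(2) by (simp add: r_def)
      finally show ?thesis using 0 by simp
    next
      case (Suc b)
      let ?skip = "\<lambda>i. if i \<le> k then i else Suc i"
      let ?F = "\<lambda>i. (w i)\<^sup>2 * (V b (\<sigma> i))\<^sup>2 * \<beta> i"
      have "s\<^sup>2 * \<beta> k + c\<^sup>2 * \<beta> (Suc k) = (c\<^sup>2 + s\<^sup>2) * (\<beta> k + \<beta> (Suc k)) - \<alpha> 0"
        unfolding cs(2)[symmetric] by (simp add: algebra_simps)
      then have \<mu>k: "s\<^sup>2 * \<beta> k + c\<^sup>2 * \<beta> (Suc k) = \<mu> k" by (simp add: cs(1) \<mu>_def)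
      have "(\<Sum>i<Suc N. (U a i)\<^sup>2 * \<beta> i) = (\<Sum>i<Suc N. ?F i)"
        by (simp only: U_def Suc nat.case power_mult_distrib)
      also have "\<dots> = ?F (Suc k) + (\<Sum>i<N. ?F (?skip i))"
        by (rule sum_lessThan_Suc_skip[OF k])
      also have "(\<Sum>i<N. ?F (?skip i)) = ?F k + (\<Sum>i\<in>{..<N} - {k}. ?F (?skip i))"
        using k by (subst sum.remove[of _ k]) auto
      also have "(\<Sum>i\<in>{..<N} - {k}. ?F (?skip i)) = (\<Sum>i\<in>{..<N} - {k}. (V b i)\<^sup>2 * \<mu> i)"
        by (rule sum.cong) (auto simp: w_def \<sigma>_def \<mu>_def)
      also have "?F (Suc k) + (?F k + \<dots>) = (V b k)\<^sup>2 * (s\<^sup>2 * \<beta> k + c\<^sup>2 * \<beta> (Suc k)) + (\<Sum>i\<in>{..<N} - {k}. (V b i)\<^sup>2 * \<mu> i)"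
        by (simp add: w_def \<sigma>_def algebra_simps)
      also have "\<dots> = (\<Sum>i<N. (V b i)\<^sup>2 * \<mu> i)"
        unfolding \<mu>k using k by (subst sum.remove[of "{..<N}" k]) auto
      also have "\<dots> = \<alpha> a" using V_diag[of b] a Suc by simp
      finally show ?thesis .
    qed
    ultimately show ?thesis by blast
  qed
qed

section \<open>Unitary diagonalization of Hermitian matrices\<close>

lemma mat_adjoint_dim [simp]:
  "dim_row (mat_adjoint A) = dim_col A" "dim_col (mat_adjoint A) = dim_row A"
  by (simp_all add: mat_adjoint_def)

lemma mat_adjoint_carrier [simp]: "A \<in> carrier_mat r c \<Longrightarrow> mat_adjoint A \<in> carrier_mat c r"
  by (intro carrier_matI) auto

lemma mat_adjoint_index [simp]:
  "i < dim_col A \<Longrightarrow> j < dim_row A \<Longrightarrow> mat_adjoint A $$ (i, j) = conjugate (A $$ (j, i))"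
  by (simp add: mat_adjoint_def mat_of_rows_def)

lemma mat_adjoint_adjoint [simp]: "mat_adjoint (mat_adjoint A) = (A :: complex mat)"
  by (rule eq_matI) auto

lemma mat_adjoint_mult:
  fixes A B :: "complex mat"
  assumes "dim_col A = dim_row B"
  shows "mat_adjoint (A * B) = mat_adjoint B * mat_adjoint A"
  by (rule eq_matI) (use assms in \<open>auto simp: scalar_prod_def mult.commute intro!: sum.cong\<close>)

lemma mat_adjoint_mult_index:
  fixes A :: "complex mat"
  assumes "A \<in> carrier_mat r c" "i < c" "j < c"
  shows "(mat_adjoint A * A) $$ (i, j) = (\<Sum>a<r. cnj (A $$ (a, i)) * A $$ (a, j))"
  using assms by (auto simp: scalar_prod_def atLeast0LessThan intro!: sum.cong)

text \<open>Complete \<open>v\<close> to a basis, orthogonalize, and normalize the resulting columns.\<close>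

lemma unitary_with_first_column:
  fixes v :: "complex vec"
  assumes v: "v \<in> carrier_vec n" and v0: "v \<noteq> 0\<^sub>v n"
  obtains W where "W \<in> carrier_mat n n" "mat_adjoint W * W = 1\<^sub>m n"
    "\<exists>c. c \<noteq> 0 \<and> col W 0 = c \<cdot>\<^sub>v v"
proof -
  interpret cof_vec_space n "TYPE(complex)" .
  define b where "b = basis_completion v"
  define ws where "ws = gram_schmidt n b"
  from basis_completion[OF v v0, folded b_def]
  have dist_b: "distinct b" and indep: "\<not> lin_dep (set b)" and b: "set b \<subseteq> carrier_vec n"
    and hdb: "hd b = v" and len_b: "length b = n" by auto
  have n: "n \<noteq> 0" using v v0 by (metis carrier_vecD eq_vecI index_zero_vec(2) not_less_zero)
  with hdb len_b obtain vs where bv: "b = v # vs" by (cases b) auto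
  from gram_schmidt_result[OF b dist_b indep refl, folded ws_def]
  have ws: "set ws \<subseteq> carrier_vec n" "corthogonal ws" "length ws = n"
    by (auto simp: len_b)
  from gram_schmidt_hd[OF v, of vs, folded bv] have hdws: "ws ! 0 = v"
    unfolding ws_def using ws n by (metis hd_conv_nth list.size(3) ws_def)
  define r where "r i = complex_of_real (1 / cvec_norm (ws ! i))" for i
  define W where "W = mat n n (\<lambda>(a, i). r i * ws ! i $ a)"
  have W: "W \<in> carrier_mat n n" by (simp add: W_def)
  have wsc: "ws ! i \<in> carrier_vec n" if "i < n" for i using ws that by auto
  have sq: "cnj (ws ! i \<bullet>c ws ! i) = ws ! i \<bullet>c ws ! i \<and> ws ! i \<bullet>c ws ! i = (cvec_norm (ws ! i))\<^sup>2
      \<and> cvec_norm (ws ! i) \<noteq> 0" if "i < n" for i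
  proof -
    have "ws ! i \<bullet>c ws ! i \<ge> 0" by (rule conjugate_square_ge_0_vec)
    moreover have "ws ! i \<bullet>c ws ! i \<noteq> 0" using corthogonalD[OF ws(2), of i i] that ws(3) by simp
    ultimately show ?thesis by (auto simp: cvec_norm_def less_eq_complex_def complex_eq_iff)
  qed
  have "mat_adjoint W * W = 1\<^sub>m n"
  proof (rule eq_matI)
    fix i j assume "i < dim_row (1\<^sub>m n :: complex mat)" "j < dim_col (1\<^sub>m n :: complex mat)"
    then have ij: "i < n" "j < n" by simp_all
    have "(mat_adjoint W * W) $$ (i, j) = (\<Sum>a<n. cnj (r i * ws ! i $ a) * (r j * ws ! j $ a))"
      using mat_adjoint_mult_index[OF W ij] ij by (simp add: W_def)
    also have "\<dots> = r i * r j * (\<Sum>a<n. ws ! j $ a * cnj (ws ! i $ a))"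
      by (simp add: sum_distrib_left mult_ac r_def)
    also have "(\<Sum>a<n. ws ! j $ a * cnj (ws ! i $ a)) = ws ! j \<bullet>c ws ! i"
      using wsc[OF ij(1)] wsc[OF ij(2)] by (auto simp: scalar_prod_def atLeast0LessThan intro!: sum.cong)
    also have "r i * r j * (ws ! j \<bullet>c ws ! i) = (1\<^sub>m n) $$ (i, j)"
    proof (cases "i = j")
      case True
      then show ?thesis using sq[OF ij(1)] ij
        by (simp add: r_def power2_eq_square)
    next
      case False
      then show ?thesis using corthogonalD[OF ws(2), of j i] ws(3) ij by simp
    qed
    finally show "(mat_adjoint W * W) $$ (i, j) = (1\<^sub>m n) $$ (i, j)" .
  qed (use W in \<open>auto simp: mat_adjoint_def\<close>)
  moreover have "col W 0 = r 0 \<cdot>\<^sub>v v"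
    using n v hdws by (intro eq_vecI) (auto simp: W_def)
  moreover have "r 0 \<noteq> 0" using sq[of 0] n by (simp add: r_def)
  ultimately show ?thesis using that[OF W] by blast
qed

text \<open>Induction on \<open>n\<close>: conjugation by a unitary matrix whose first column is an eigenvector clears the
  first column below the diagonal, hence by symmetry also the first row, and leaves a Hermitian block of
  size \<open>n - 1\<close>.\<close>

theorem hermitian_unitary_diagonalization:
  fixes A :: "complex mat"
  assumes "A \<in> carrier_mat n n" "mat_adjoint A = A"
  shows "\<exists>U D. U \<in> carrier_mat n n \<and> D \<in> carrier_mat n n \<and> mat_adjoint U * U = 1\<^sub>m n \<and>
    mat_adjoint U * A * U = D \<and> diagonal_mat D"
  using assms
proof (induction n arbitrary: A)
  case 0
  then show ?case
    by (intro exI[of _ "1\<^sub>m 0"]) (auto simp: diagonal_mat_def mat_adjoint_def)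
next
  case (Suc n)
  note A = Suc.prems(1) and herm = Suc.prems(2)
  have "degree (char_poly A) = Suc n" using degree_monic_char_poly[OF A] by simp
  then have "\<not> constant (poly (char_poly A))"
    by (simp add: constant_degree)
  then obtain e where "poly (char_poly A) e = 0"
    using fundamental_theorem_of_algebra by blast
  then obtain v where "eigenvector A v e"
    using eigenvalue_root_char_poly[OF A] unfolding eigenvalue_def by blast
  then have v: "v \<in> carrier_vec (Suc n)" "v \<noteq> 0\<^sub>v (Suc n)" and Av: "A *\<^sub>v v = e \<cdot>\<^sub>v v"
    using A by (auto simp: eigenvector_def)
  obtain W c where W: "W \<in> carrier_mat (Suc n) (Suc n)" and WW: "mat_adjoint W * W = 1\<^sub>m (Suc n)"
    and c: "c \<noteq> 0" "col W 0 = c \<cdot>\<^sub>v v"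
    by (rule unitary_with_first_column[OF v]) blast
  have W': "mat_adjoint W \<in> carrier_mat (Suc n) (Suc n)" using W by simp
  define B where "B = mat_adjoint W * A * W"
  have B: "B \<in> carrier_mat (Suc n) (Suc n)" using W W' A by (auto simp: B_def)
  have "mat_adjoint B = mat_adjoint W * mat_adjoint (mat_adjoint W * A)"
    unfolding B_def by (rule mat_adjoint_mult) (use W A in auto)
  also have "mat_adjoint (mat_adjoint W * A) = A * W"
    using W A herm by (subst mat_adjoint_mult) auto
  also have "mat_adjoint W * (A * W) = B"
    unfolding B_def using assoc_mult_mat[OF W' A W] by simp
  finally have herm_B: "mat_adjoint B = B" .
  have B_sym: "B $$ (i, j) = cnj (B $$ (j, i))" if "i < Suc n" "j < Suc n" for i j
  proof -
    have "mat_adjoint B $$ (i, j) = conjugate (B $$ (j, i))"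
      by (rule mat_adjoint_index) (use B that in auto)
    then show ?thesis using herm_B by simp
  qed
  have "A *\<^sub>v col W 0 = e \<cdot>\<^sub>v col W 0"
    using A v Av c by (simp add: mult_mat_vec smult_smult_assoc mult.commute)
  have col0: "col B 0 = e \<cdot>\<^sub>v unit_vec (Suc n) 0"
  proof -
    have "col B 0 = mat_adjoint W *\<^sub>v (A *\<^sub>v col W 0)"
      unfolding B_def using W W' A
      by (metis assoc_mult_mat_vec col_carrier_vec col_mult2 mult_carrier_mat zero_less_Suc)
    also have "\<dots> = mat_adjoint W *\<^sub>v (e \<cdot>\<^sub>v col W 0)" using \<open>A *\<^sub>v col W 0 = e \<cdot>\<^sub>v col W 0\<close> by simp
    also have "\<dots> = e \<cdot>\<^sub>v (mat_adjoint W *\<^sub>v col W 0)"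
      using W W' by (intro mult_mat_vec) auto
    also have "mat_adjoint W *\<^sub>v col W 0 = unit_vec (Suc n) 0"
      by (metis W W' WW col_mult2 col_one zero_less_Suc)
    finally show ?thesis .
  qed
  have B0: "B $$ (i, 0) = 0" "B $$ (0, i) = 0" if i: "0 < i" "i < Suc n" for i
  proof -
    have "B $$ (i, 0) = col B 0 $ i" using B i by auto
    also have "\<dots> = 0" using i by (simp add: col0)
    finally show "B $$ (i, 0) = 0" .
    then show "B $$ (0, i) = 0" using i by (subst B_sym) simp_all
  qed
  define B' where "B' = mat n n (\<lambda>(i, j). B $$ (Suc i, Suc j))"
  have "mat_adjoint B' = B'"
    by (intro eq_matI) (auto simp: B'_def intro!: B_sym[symmetric])
  with Suc.IH[of B'] obtain V D' where V: "V \<in> carrier_mat n n" and D': "D' \<in> carrier_mat n n"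
    and VV: "mat_adjoint V * V = 1\<^sub>m n" and VBV: "mat_adjoint V * B' * V = D'" and diag: "diagonal_mat D'"
    by (auto simp: B'_def)
  have B': "B' \<in> carrier_mat n n" by (simp add: B'_def)
  have V': "mat_adjoint V \<in> carrier_mat n n" using V by simp
  let ?e = "mat 1 1 (\<lambda>_. e)" and ?zr = "0\<^sub>m 1 n :: complex mat" and ?zc = "0\<^sub>m n 1 :: complex mat"
  have B_block: "B = four_block_mat ?e ?zr ?zc B'"
  proof (rule eq_matI)
    fix i j assume "i < dim_row (four_block_mat ?e ?zr ?zc B')" "j < dim_col (four_block_mat ?e ?zr ?zc B')"
    then have ij: "i < Suc n" "j < Suc n" by (auto simp: B'_def)
    have "B $$ (0, 0) = col B 0 $ 0" using B by auto
    then have "B $$ (0, 0) = e" by (simp add: col0)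
    then show "B $$ (i, j) = four_block_mat ?e ?zr ?zc B' $$ (i, j)"
      using ij B0 by (cases i; cases j) (auto simp: B'_def)
  qed (use B in \<open>auto simp: B'_def\<close>)
  define V1 where "V1 = four_block_mat (1\<^sub>m 1) ?zr ?zc V"
  define V1' where "V1' = four_block_mat (1\<^sub>m 1) ?zr ?zc (mat_adjoint V)"
  define D where "D = four_block_mat ?e ?zr ?zc D'"
  have V1: "V1 \<in> carrier_mat (Suc n) (Suc n)" and V1': "V1' \<in> carrier_mat (Suc n) (Suc n)"
    and D: "D \<in> carrier_mat (Suc n) (Suc n)"
    using V V' D' by (auto simp: V1_def V1'_def D_def)
  have adj_V1: "mat_adjoint V1 = V1'"
  proof (rule eq_matI)
    fix i j assume "i < dim_row V1'" "j < dim_col V1'"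
    then have "i < Suc n" "j < Suc n" using V1' by auto
    then show "mat_adjoint V1 $$ (i, j) = V1' $$ (i, j)"
      using V V' V1 by (cases i; cases j) (auto simp: V1_def V1'_def)
  qed (use V1 V1' in \<open>auto simp: mat_adjoint_def\<close>)
  have blk: "four_block_mat X ?zr ?zc Y * four_block_mat X2 ?zr ?zc Y2 = four_block_mat (X * X2) ?zr ?zc (Y * Y2)"
    if "X \<in> carrier_mat 1 1" "X2 \<in> carrier_mat 1 1" "Y \<in> carrier_mat n n" "Y2 \<in> carrier_mat n n" for X X2 Y Y2
    using that by (subst mult_four_block_mat[of _ 1 1 _ n _ n _ _ 1 _ n]) auto
  have V1V1: "V1' * V1 = 1\<^sub>m (Suc n)"
    unfolding V1_def V1'_def using V V' VV by (subst blk) (auto intro!: eq_matI)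
  have "V1' * B = four_block_mat (1\<^sub>m 1 * ?e) ?zr ?zc (mat_adjoint V * B')"
    unfolding V1'_def B_block by (rule blk) (use V' B' in auto)
  also have "\<dots> * V1 = four_block_mat (1\<^sub>m 1 * ?e * 1\<^sub>m 1) ?zr ?zc (mat_adjoint V * B' * V)"
    unfolding V1_def by (rule blk) (use V V' B' in auto)
  also have "\<dots> = D" unfolding D_def VBV by simp
  finally have V1BV1: "V1' * B * V1 = D" .
  define U where "U = W * V1"
  have U: "U \<in> carrier_mat (Suc n) (Suc n)" using W V1 by (simp add: U_def)
  have adj_U: "mat_adjoint U = V1' * mat_adjoint W"
    unfolding U_def using mat_adjoint_mult[of W V1] adj_V1 W V1 by simp
  have WV: "W * V1 \<in> carrier_mat (Suc n) (Suc n)" and WA: "mat_adjoint W * A \<in> carrier_mat (Suc n) (Suc n)"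
    using W W' A V1 by auto
  have "mat_adjoint U * U = V1' * (mat_adjoint W * (W * V1))"
    unfolding adj_U unfolding U_def by (rule assoc_mult_mat[OF V1' W' WV])
  also have "mat_adjoint W * (W * V1) = V1"
    using assoc_mult_mat[OF W' W V1] WW V1 by simp
  finally have "mat_adjoint U * U = 1\<^sub>m (Suc n)" using V1V1 by simp
  moreover have "mat_adjoint U * A * U = D"
  proof -
    have "mat_adjoint U * A * U = V1' * (mat_adjoint W * A) * (W * V1)"
      unfolding adj_U unfolding U_def using assoc_mult_mat[OF V1' W' A] by simp
    also have "\<dots> = V1' * ((mat_adjoint W * A) * (W * V1))"
      by (rule assoc_mult_mat[OF V1' WA WV])
    also have "(mat_adjoint W * A) * (W * V1) = B * V1"
      unfolding B_def by (rule assoc_mult_mat[OF WA W V1, symmetric])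
    also have "V1' * (B * V1) = D"
      using assoc_mult_mat[OF V1' B V1] V1BV1 by simp
    finally show ?thesis .
  qed
  moreover have "diagonal_mat D"
    using diag D' unfolding diagonal_mat_def D_def
    by auto
  ultimately show ?case using U D by blast
qed

section \<open>Spectra of frame operators\<close>

lemma mset_spectrum_decr_upper_triangular:
  assumes "A \<in> carrier_mat k k" "upper_triangular A"
  shows "mset (spectrum_decr A) = image_mset (\<lambda>i. Re (A $$ (i, i))) (mset [0..<k])"
proof -
  have linear: "proots (\<Prod>a\<leftarrow>as. [:- a, 1:]) = mset as" for as :: "complex list"
  proof (induction as)
    case (Cons a as)
    have "(\<Prod>a\<leftarrow>as. [:- a, 1:]) \<noteq> 0" by (auto simp: prod_list_zero_iff)
    then show ?case using Cons by (simp add: proots_mult del: mult_pCons_left)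
  qed simp
  have "diag_mat A = map (\<lambda>i. A $$ (i, i)) [0..<k]"
    using assms(1) by (simp add: diag_mat_def)
  then show ?thesis
    using char_poly_upper_triangular[OF assms] linear[of "diag_mat A"]
    by (simp add: spectrum_decr_def multiset.map_comp o_def)
qed

lemma sorted_spectrum_decr: "sorted_wrt (\<ge>) (spectrum_decr A)"
  by (simp add: spectrum_decr_def sorted_wrt_rev)

lemma frame_mat_carrier [simp]: "frame_mat k n F \<in> carrier_mat k k"
  by (simp add: frame_mat_def)

lemma frame_mat_index:
  assumes F: "\<And>s. s \<in> {1..n} \<Longrightarrow> F s \<in> carrier_vec k" and ab: "a < k" "b < k"
  shows "frame_mat k n F $$ (a, b) = (\<Sum>s=1..n. F s $ a * cnj (F s $ b))"
proof -
  have "frame_mat k n F $$ (a, b) = (\<Sum>s=1..n. (unit_vec k b \<bullet>c F s) * F s $ a)"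
    using ab frame_op_index[of n F k a, OF F ab(1)] by (simp add: frame_mat_def)
  also have "\<dots> = (\<Sum>s=1..n. F s $ a * cnj (F s $ b))"
  proof (rule sum.cong)
    fix s assume "s \<in> {1..n}"
    then have "F s \<in> carrier_vec k" by (rule F)
    then show "(unit_vec k b \<bullet>c F s) * F s $ a = F s $ a * cnj (F s $ b)"
      using ab by (simp add: scalar_prod_left_unit)
  qed simp
  finally show ?thesis .
qed

lemma cvec_norm_sq:
  assumes "v \<in> carrier_vec k"
  shows "(cvec_norm v)\<^sup>2 = (\<Sum>a<k. (cmod (v $ a))\<^sup>2)"
proof -
  have "v \<bullet>c v = (\<Sum>a<k. v $ a * cnj (v $ a))"
    using assms by (auto simp: scalar_prod_def atLeast0LessThan intro!: sum.cong)
  also have "\<dots> = complex_of_real (\<Sum>a<k. (cmod (v $ a))\<^sup>2)"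
    by (simp add: complex_norm_square[symmetric] del: of_real_power)
  finally have "Re (v \<bullet>c v) = (\<Sum>a<k. (cmod (v $ a))\<^sup>2)" by simp
  moreover have "0 \<le> (\<Sum>a<k. (cmod (v $ a))\<^sup>2)" by (rule sum_nonneg) simp
  ultimately show ?thesis by (simp add: cvec_norm_def)
qed

text \<open>\<open>C\<^sub>i\<^sub>s\<close> is the \<open>i\<close>-th coordinate of the \<open>s\<close>-th frame vector in an orthonormal eigenbasis of the frame
  operator. If \<open>M\<close> has the frame vectors as its columns and \<open>N = U\<^sup>* M\<close> is the matrix of the
  coordinates, then \<open>N N\<^sup>* = U\<^sup>* M M\<^sup>* U\<close> is diagonal and \<open>N\<^sup>* N = M\<^sup>* M\<close> has the squared norms on its
  diagonal.\<close>

lemma frame_eigenbasis_coefficients: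
  fixes F :: "nat \<Rightarrow> complex vec"
  assumes F: "\<And>s. s \<in> {1..n} \<Longrightarrow> F s \<in> carrier_vec k"
  shows "\<exists>(C :: nat \<Rightarrow> nat \<Rightarrow> complex) (ev :: nat \<Rightarrow> real).
    (\<forall>i<k. \<forall>i'<k. (\<Sum>s=1..n. C i s * cnj (C i' s)) = (if i = i' then complex_of_real (ev i) else 0)) \<and>
    (\<forall>s\<in>{1..n}. (cvec_norm (F s))\<^sup>2 = (\<Sum>i<k. (cmod (C i s))\<^sup>2)) \<and>
    mset (spectrum_decr (frame_mat k n F)) = image_mset ev (mset [0..<k])"
proof -
  let ?A = "frame_mat k n F"
  define M where "M = mat k n (\<lambda>(a, s). F (Suc s) $ a)"
  have M: "M \<in> carrier_mat k n" by (simp add: M_def)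
  have M': "mat_adjoint M \<in> carrier_mat n k" using M by simp
  have shift: "(\<Sum>s=1..n. f s) = (\<Sum>s<n. f (Suc s))" for f :: "nat \<Rightarrow> complex"
    by (simp add: sum.atLeast1_atMost_eq)
  have A_eq: "?A = M * mat_adjoint M"
  proof (rule eq_matI)
    fix a b assume "a < dim_row (M * mat_adjoint M)" "b < dim_col (M * mat_adjoint M)"
    then have ab: "a < k" "b < k" using M by auto
    have "?A $$ (a, b) = (\<Sum>s<n. F (Suc s) $ a * cnj (F (Suc s) $ b))"
      using frame_mat_index[OF F ab] shift by simp
    also have "\<dots> = (M * mat_adjoint M) $$ (a, b)"
      using ab by (auto simp: M_def scalar_prod_def atLeast0LessThan intro!: sum.cong)
    finally show "?A $$ (a, b) = (M * mat_adjoint M) $$ (a, b)" .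
  qed (use M in \<open>auto simp: frame_mat_def\<close>)
  have "mat_adjoint ?A = ?A"
    unfolding A_eq using M by (subst mat_adjoint_mult) auto
  then obtain U D where U: "U \<in> carrier_mat k k" and D: "D \<in> carrier_mat k k"
    and UU: "mat_adjoint U * U = 1\<^sub>m k" and UAU: "mat_adjoint U * ?A * U = D" and diag: "diagonal_mat D"
    using hermitian_unitary_diagonalization[OF frame_mat_carrier] by blast
  have U': "mat_adjoint U \<in> carrier_mat k k" using U by simp
  have UU': "U * mat_adjoint U = 1\<^sub>m k"
    using mat_mult_left_right_inverse[OF U' U UU] .
  have "similar_mat_wit D ?A (mat_adjoint U) U"
    by (rule similar_mat_witI[OF UU UU']) (use UAU U U' D in auto)
  then have "char_poly ?A = char_poly D"
    using char_poly_similar similar_mat_def by metis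
  moreover have "upper_triangular D"
    using diag D by (auto simp: diagonal_mat_def upper_triangular_def)
  ultimately have spec: "mset (spectrum_decr ?A) = image_mset (\<lambda>i. Re (D $$ (i, i))) (mset [0..<k])"
    using mset_spectrum_decr_upper_triangular[OF D] by (simp add: spectrum_decr_def)
  define N where "N = mat_adjoint U * M"
  have N: "N \<in> carrier_mat k n" using U' M by (simp add: N_def)
  have N': "mat_adjoint N \<in> carrier_mat n k" using N by simp
  have adj_N: "mat_adjoint N = mat_adjoint M * U"
    unfolding N_def using U M by (subst mat_adjoint_mult) auto
  have "mat_adjoint U * ?A * U = mat_adjoint U * (?A * U)"
    by (rule assoc_mult_mat[OF U' frame_mat_carrier U])
  also have "?A * U = M * (mat_adjoint M * U)"
    unfolding A_eq by (rule assoc_mult_mat[OF M M' U])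
  also have "mat_adjoint U * \<dots> = N * mat_adjoint N"
    unfolding adj_N unfolding N_def using assoc_mult_mat[OF U' M, of "mat_adjoint M * U" k] M' U by simp
  finally have NN: "N * mat_adjoint N = D" using UAU by simp
  have "mat_adjoint N * N = mat_adjoint M * (U * N)"
    unfolding adj_N by (rule assoc_mult_mat[OF M' U N])
  also have "U * N = (U * mat_adjoint U) * M"
    unfolding N_def by (rule assoc_mult_mat[OF U U' M, symmetric])
  also have "\<dots> = M" using UU' M by simp
  finally have NM: "mat_adjoint N * N = mat_adjoint M * M" .
  define C where "C i s = N $$ (i, s - 1)" for i s
  have rows: "(\<Sum>s=1..n. C i s * cnj (C i' s)) = D $$ (i, i')" if i: "i < k" "i' < k" for i i'
  proof -
    have "(\<Sum>s=1..n. C i s * cnj (C i' s)) = (\<Sum>s<n. N $$ (i, s) * cnj (N $$ (i', s)))"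
      unfolding shift C_def by simp
    also have "\<dots> = (N * mat_adjoint N) $$ (i, i')"
      using i N by (auto simp: scalar_prod_def atLeast0LessThan intro!: sum.cong)
    finally show ?thesis by (simp only: NN)
  qed
  show ?thesis
  proof (intro exI[of _ C] exI[of _ "\<lambda>i. Re (D $$ (i, i))"] conjI allI impI ballI)
    fix i i' assume i: "i < k" "i' < k"
    show "(\<Sum>s=1..n. C i s * cnj (C i' s)) = (if i = i' then complex_of_real (Re (D $$ (i, i))) else 0)"
    proof (cases "i = i'")
      case True
      have "D $$ (i, i) = complex_of_real (\<Sum>s=1..n. (cmod (C i s))\<^sup>2)"
        using rows[OF i(1) i(1)] by (simp add: complex_norm_square[symmetric] del: of_real_power)
      then show ?thesis using rows[OF i] True by simp
    next
      case False
      then show ?thesis using rows[OF i] diag D i by (auto simp: diagonal_mat_def)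
    qed
  next
    fix s assume s: "s \<in> {1..n}"
    then have s': "s - 1 < n" "Suc (s - 1) = s" by auto
    have "complex_of_real (\<Sum>i<k. (cmod (C i s))\<^sup>2) = (\<Sum>i<k. cnj (N $$ (i, s - 1)) * N $$ (i, s - 1))"
      unfolding C_def of_real_sum by (rule sum.cong) (simp_all add: complex_norm_square mult.commute del: of_real_power)
    also have "\<dots> = (\<Sum>i<k. cnj (M $$ (i, s - 1)) * M $$ (i, s - 1))"
      using mat_adjoint_mult_index[OF N s'(1) s'(1)] mat_adjoint_mult_index[OF M s'(1) s'(1)] NM by simp
    also have "\<dots> = complex_of_real (\<Sum>i<k. (cmod (F s $ i))\<^sup>2)"
      unfolding of_real_sum using s' by (intro sum.cong) (auto simp: M_def complex_norm_square mult.commute simp del: of_real_power)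
    finally show "(cvec_norm (F s))\<^sup>2 = (\<Sum>i<k. (cmod (C i s))\<^sup>2)"
      using cvec_norm_sq[OF F[OF s]] by (simp only: of_real_eq_iff)
  qed (rule spec)
qed

text \<open>Bessel's inequality for the \<open>s\<close>-th unit vector and the orthonormal system of the rows divided by
  \<open>\<surd>ev\<^sub>i\<close>. Rows with \<open>ev\<^sub>i = 0\<close> drop out, because division by zero yields zero.\<close>

lemma orthogonal_rows_column_bound:
  fixes C :: "'i \<Rightarrow> 's \<Rightarrow> complex" and ev :: "'i \<Rightarrow> real"
  assumes fin: "finite I" "finite T" and s: "s \<in> T"
    and orth: "\<And>i i'. i \<in> I \<Longrightarrow> i' \<in> I \<Longrightarrow>
      (\<Sum>s\<in>T. C i s * cnj (C i' s)) = (if i = i' then complex_of_real (ev i) else 0)"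
  shows "(\<Sum>i\<in>I. (cmod (C i s))\<^sup>2 / ev i) \<le> 1"
proof -
  define w where "w = (\<Sum>i\<in>I. (cmod (C i s))\<^sup>2 / ev i)"
  \<comment> \<open>\<open>z\<close> is the projection of the \<open>s\<close>-th unit vector to the span of the rows. Its squared length
    is \<open>w\<close>, and so is its \<open>s\<close>-th coordinate, whence \<open>w\<^sup>2 \<le> w\<close>.\<close>
  define z where "z b = (\<Sum>i\<in>I. C i b * (cnj (C i s) / ev i))" for b
  have "z s = (\<Sum>i\<in>I. complex_of_real ((cmod (C i s))\<^sup>2 / ev i))"
    unfolding z_def by (rule sum.cong) (simp_all add: complex_norm_square[symmetric] del: of_real_power)
  then have zs: "z s = complex_of_real w" by (simp add: w_def)
  have "complex_of_real (\<Sum>b\<in>T. (cmod (z b))\<^sup>2) = (\<Sum>b\<in>T. z b * cnj (z b))"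
    by (simp add: complex_norm_square del: of_real_power)
  also have "\<dots> = (\<Sum>b\<in>T. \<Sum>i\<in>I. \<Sum>i'\<in>I.
      (cnj (C i s) / ev i) * (C i' s / ev i') * (C i b * cnj (C i' b)))"
    unfolding z_def cnj_sum sum_product by (simp add: mult_ac)
  also have "\<dots> = (\<Sum>i\<in>I. \<Sum>i'\<in>I. \<Sum>b\<in>T.
      (cnj (C i s) / ev i) * (C i' s / ev i') * (C i b * cnj (C i' b)))"
    by (subst sum.swap) (rule sum.cong[OF refl sum.swap])
  also have "\<dots> = (\<Sum>i\<in>I. \<Sum>i'\<in>I.
      if i = i' then (cnj (C i s) / ev i) * (C i' s / ev i') * ev i else 0)"
    by (intro sum.cong refl, unfold sum_distrib_left[symmetric]) (simp add: orth)
  also have "\<dots> = (\<Sum>i\<in>I. (cnj (C i s) / ev i) * (C i s / ev i) * ev i)"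
    using fin by simp
  also have "\<dots> = (\<Sum>i\<in>I. complex_of_real ((cmod (C i s))\<^sup>2 / ev i))"
  proof (rule sum.cong)
    fix i
    have "complex_of_real ((cmod (C i s))\<^sup>2 / ev i) = C i s * cnj (C i s) / ev i"
      unfolding of_real_divide by (simp only: complex_norm_square)
    then show "(cnj (C i s) / ev i) * (C i s / ev i) * ev i = complex_of_real ((cmod (C i s))\<^sup>2 / ev i)"
      by (cases "ev i = 0") simp_all
  qed simp
  finally have "(\<Sum>b\<in>T. (cmod (z b))\<^sup>2) = w"
    unfolding w_def of_real_sum[symmetric] by (simp only: of_real_eq_iff)
  moreover have "(cmod (z s))\<^sup>2 \<le> (\<Sum>b\<in>T. (cmod (z b))\<^sup>2)"
    using fin s by (intro member_le_sum) auto
  ultimately have w: "w * w \<le> w" using zs by (simp add: power2_eq_square)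
  have "w \<le> 1"
  proof (rule ccontr)
    assume "\<not> w \<le> 1"
    then have "w * 1 < w * w" by (intro mult_strict_left_mono) auto
    with w show False by simp
  qed
  then show ?thesis by (simp only: w_def)
qed

text \<open>The total energy of the columns in \<open>S\<close> is \<open>\<Sum>\<^sub>i ev\<^sub>i W\<^sub>i\<close>, where \<open>W\<^sub>i\<close> is the share of the \<open>i\<close>-th row
  that lies in these columns. The weights lie in \<open>[0,1]\<close>, so \<open>W\<^sub>i (ev\<^sub>i - t) \<le> (ev\<^sub>i - t)\<^sup>+\<close>, and their sum is at
  most \<open>card I\<close> and, by the column bound, at most \<open>card S\<close>. This is Ky Fan's
  maximum principle, stated with a threshold instead of sorted eigenvalues.\<close>

lemma hinge_sum_ge_partial_energy:
  fixes C :: "'i \<Rightarrow> 's \<Rightarrow> complex" and ev :: "'i \<Rightarrow> real"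
  assumes fin: "finite I" "finite T" and S: "S \<subseteq> T" and t: "0 \<le> t"
    and orth: "\<And>i i'. i \<in> I \<Longrightarrow> i' \<in> I \<Longrightarrow>
      (\<Sum>s\<in>T. C i s * cnj (C i' s)) = (if i = i' then complex_of_real (ev i) else 0)"
  shows "(\<Sum>s\<in>S. \<Sum>i\<in>I. (cmod (C i s))\<^sup>2) - t * real (min (card S) (card I))
    \<le> (\<Sum>i\<in>I. max 0 (ev i - t))"
proof -
  have finS: "finite S" using S fin finite_subset by blast
  define W where "W i = (\<Sum>s\<in>S. (cmod (C i s))\<^sup>2 / ev i)" for i
  have ev: "(\<Sum>s\<in>T. (cmod (C i s))\<^sup>2) = ev i" if "i \<in> I" for i
  proof -
    have "complex_of_real (\<Sum>s\<in>T. (cmod (C i s))\<^sup>2) = complex_of_real (ev i)"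
      using orth[OF that that] by (simp add: complex_norm_square del: of_real_power)
    then show ?thesis by (simp only: of_real_eq_iff)
  qed
  have ev0: "0 \<le> ev i" if "i \<in> I" for i
    unfolding ev[OF that, symmetric] by (rule sum_nonneg) simp
  have part: "(\<Sum>s\<in>S. (cmod (C i s))\<^sup>2) \<le> ev i" if "i \<in> I" for i
    unfolding ev[OF that, symmetric] by (rule sum_mono2) (use fin S in auto)
  have W0: "0 \<le> W i" if "i \<in> I" for i
    unfolding W_def using ev0[OF that] by (intro sum_nonneg) auto
  have W1: "W i \<le> 1" if "i \<in> I" for i
    unfolding W_def sum_divide_distrib[symmetric]
    using part[OF that] ev0[OF that] by (auto simp: divide_le_eq_1)
  have evW: "ev i * W i = (\<Sum>s\<in>S. (cmod (C i s))\<^sup>2)" if "i \<in> I" for i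
  proof (cases "ev i = 0")
    case True
    have "0 \<le> (\<Sum>s\<in>S. (cmod (C i s))\<^sup>2)" by (rule sum_nonneg) simp
    then show ?thesis using part[OF that] True by simp
  qed (simp add: W_def sum_divide_distrib[symmetric])
  have "(\<Sum>i\<in>I. W i) = (\<Sum>s\<in>S. \<Sum>i\<in>I. (cmod (C i s))\<^sup>2 / ev i)"
    unfolding W_def by (rule sum.swap)
  also have "\<dots> \<le> (\<Sum>s\<in>S. 1)"
    by (rule sum_mono, rule orthogonal_rows_column_bound[OF fin _ orth]) (use S in auto)
  finally have W_card_S: "(\<Sum>i\<in>I. W i) \<le> real (card S)" by simp
  have "(\<Sum>i\<in>I. W i) \<le> (\<Sum>i\<in>I. 1)"
    by (rule sum_mono) (rule W1)
  then have W_min: "(\<Sum>i\<in>I. W i) \<le> real (min (card S) (card I))"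
    using W_card_S by simp
  have "(\<Sum>s\<in>S. \<Sum>i\<in>I. (cmod (C i s))\<^sup>2) = (\<Sum>i\<in>I. ev i * W i)"
    by (subst sum.swap) (simp add: evW)
  then have "(\<Sum>s\<in>S. \<Sum>i\<in>I. (cmod (C i s))\<^sup>2) - t * real (min (card S) (card I))
      \<le> (\<Sum>i\<in>I. ev i * W i) - t * (\<Sum>i\<in>I. W i)"
    using mult_left_mono[OF W_min t] by simp
  also have "\<dots> = (\<Sum>i\<in>I. W i * (ev i - t))"
    by (simp add: sum_distrib_left sum_subtractf algebra_simps)
  also have "\<dots> \<le> (\<Sum>i\<in>I. max 0 (ev i - t))"
  proof (rule sum_mono)
    fix i assume i: "i \<in> I"
    show "W i * (ev i - t) \<le> max 0 (ev i - t)"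
    proof (cases "t \<le> ev i")
      case True
      then show ?thesis using mult_right_mono[OF W1[OF i], of "ev i - t"] by simp
    next
      case False
      then show ?thesis using mult_nonneg_nonpos[OF W0[OF i], of "ev i - t"] by simp
    qed
  qed
  finally show ?thesis .
qed

text \<open>The spectrum is, up to order, the list of squared row norms of the coefficients in an eigenbasis, and
  the columns of these coefficients carry the norms of the frame vectors; summing the squared entries
  by rows or by columns relates the two.\<close>

lemma
  assumes F: "\<And>s. s \<in> {1..n} \<Longrightarrow> F s \<in> carrier_vec k"
  shows frame_spectrum_sum: "sum_list (spectrum_decr (frame_mat k n F)) = (\<Sum>s=1..n. (cvec_norm (F s))\<^sup>2)"
    and frame_spectrum_length: "length (spectrum_decr (frame_mat k n F)) = k"
    and frame_spectrum_hinge: "0 \<le> t \<Longrightarrow> S \<subseteq> {1..n} \<Longrightarrow>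
      (\<Sum>s\<in>S. (cvec_norm (F s))\<^sup>2) - t * real (min (card S) k)
      \<le> (\<Sum>x\<leftarrow>spectrum_decr (frame_mat k n F). max 0 (x - t))"
proof -
  let ?sp = "spectrum_decr (frame_mat k n F)"
  obtain C ev where orth: "\<And>i i'. i < k \<Longrightarrow> i' < k \<Longrightarrow>
      (\<Sum>s=1..n. C i s * cnj (C i' s)) = (if i = i' then complex_of_real (ev i) else 0)"
    and norm: "\<And>s. s \<in> {1..n} \<Longrightarrow> (cvec_norm (F s))\<^sup>2 = (\<Sum>i<k. (cmod (C i s))\<^sup>2)"
    and spec: "mset ?sp = image_mset ev (mset [0..<k])"
    using frame_eigenbasis_coefficients[of n F k, OF F] by blast
  have sum_sp: "sum_list (map f ?sp) = (\<Sum>i<k. f (ev i))" for f :: "real \<Rightarrow> real"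
  proof -
    have "mset (map f ?sp) = mset (map (\<lambda>i. f (ev i)) [0..<k])"
      unfolding mset_map spec by (simp add: multiset.map_comp o_def)
    then have "sum_list (map f ?sp) = sum_list (map (\<lambda>i. f (ev i)) [0..<k])"
      by (simp only: sum_mset_sum_list[symmetric])
    also have "\<dots> = (\<Sum>i<k. f (ev i))"
      by (simp add: interv_sum_list_conv_sum_set_nat atLeast0LessThan)
    finally show ?thesis .
  qed
  show "length ?sp = k"
    using arg_cong[OF spec, of size] by simp
  have ev: "ev i = (\<Sum>s=1..n. (cmod (C i s))\<^sup>2)" if "i < k" for i
  proof -
    have "complex_of_real (\<Sum>s=1..n. (cmod (C i s))\<^sup>2) = complex_of_real (ev i)"
      using orth[OF that that] by (simp add: complex_norm_square del: of_real_power)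
    then show ?thesis by (simp only: of_real_eq_iff)
  qed
  have "sum_list ?sp = (\<Sum>i<k. ev i)" using sum_sp[of "\<lambda>x. x"] by simp
  also have "\<dots> = (\<Sum>i<k. \<Sum>s=1..n. (cmod (C i s))\<^sup>2)"
    by (rule sum.cong) (auto simp: ev)
  also have "\<dots> = (\<Sum>s=1..n. \<Sum>i<k. (cmod (C i s))\<^sup>2)"
    by (rule sum.swap)
  also have "\<dots> = (\<Sum>s=1..n. (cvec_norm (F s))\<^sup>2)"
    by (rule sum.cong) (auto simp: norm)
  finally show "sum_list ?sp = (\<Sum>s=1..n. (cvec_norm (F s))\<^sup>2)" .
  assume t: "0 \<le> t" and S: "S \<subseteq> {1..n}"
  have "(\<Sum>s\<in>S. (cvec_norm (F s))\<^sup>2) = (\<Sum>s\<in>S. \<Sum>i<k. (cmod (C i s))\<^sup>2)"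
    by (rule sum.cong) (use norm S in auto)
  then show "(\<Sum>s\<in>S. (cvec_norm (F s))\<^sup>2) - t * real (min (card S) k)
      \<le> (\<Sum>x\<leftarrow>?sp. max 0 (x - t))"
    using hinge_sum_ge_partial_energy[of "{..<k}" "{1..n}" S t C ev] t S orth sum_sp[of "\<lambda>x. max 0 (x - t)"] by simp
qed

section \<open>Spectra of designs\<close>

lemma sum_list_concat_segment:
  fixes L :: "nat \<Rightarrow> real list" and f :: "real \<Rightarrow> real"
  shows "sum_list (map f (concat (segment L 1 m))) = (\<Sum>j=1..m. sum_list (map f (L j)))"
proof -
  have "sum_list (map f (concat (map L js))) = (\<Sum>j\<leftarrow>js. sum_list (map f (L j)))" for js
    by (induction js) auto
  then show ?thesis
    unfolding segment_def by (simp add: interv_sum_list_conv_sum_set_nat atLeastLessThanSuc_atLeastAtMost del: upt_Suc)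
qed

lemma length_concat_segment:
  "length (concat (segment L 1 m)) = (\<Sum>j=1..m. length (L j))"
  unfolding segment_def
  by (simp add: length_concat interv_sum_list_conv_sum_set_nat atLeastLessThanSuc_atLeastAtMost o_def del: upt_Suc)

lemma design_Lambda_length:
  assumes "\<Phi> \<in> designs m n \<alpha> d"
  shows "length (design_Lambda m n d \<Phi>) = (\<Sum>j=1..m. d j)"
  unfolding design_Lambda_def design_spectra_def length_concat_segment
  by (rule sum.cong) (use assms frame_spectrum_length in \<open>auto simp: designs_def\<close>)

lemma design_Lambda_sum:
  assumes "\<Phi> \<in> designs m n \<alpha> d"
  shows "sum_list (design_Lambda m n d \<Phi>) = (\<Sum>s=1..n. \<alpha> s)"
proof -
  have "sum_list (design_Lambda m n d \<Phi>) =
      (\<Sum>j=1..m. sum_list (spectrum_decr (frame_mat (d j) n (\<Phi> j))))"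
    using sum_list_concat_segment[of "\<lambda>x. x"] by (simp add: design_Lambda_def design_spectra_def)
  also have "\<dots> = (\<Sum>j=1..m. \<Sum>s=1..n. (cvec_norm (\<Phi> j s))\<^sup>2)"
    by (rule sum.cong) (use assms frame_spectrum_sum in \<open>auto simp: designs_def\<close>)
  also have "\<dots> = (\<Sum>s=1..n. \<Sum>j=1..m. (cvec_norm (\<Phi> j s))\<^sup>2)"
    by (rule sum.swap)
  also have "\<dots> = (\<Sum>s=1..n. \<alpha> s)"
    by (rule sum.cong) (use assms in \<open>auto simp: designs_def\<close>)
  finally show ?thesis .
qed

text \<open>The squared norms of the \<open>s\<close>-th vectors of a design add up to \<open>\<alpha>\<^sub>s\<close>, so the bounds for the single
  frames add up to a bound in terms of \<open>\<alpha>\<close> and the dimensions alone.\<close>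

lemma design_Lambda_hinge:
  assumes \<Phi>: "\<Phi> \<in> designs m n \<alpha> d" and t: "0 \<le> t" and S: "S \<subseteq> {1..n}"
  shows "(\<Sum>s\<in>S. \<alpha> s) - t * (\<Sum>j=1..m. real (min (card S) (d j)))
    \<le> (\<Sum>x\<leftarrow>design_Lambda m n d \<Phi>. max 0 (x - t))"
proof -
  have "(\<Sum>s\<in>S. \<alpha> s) = (\<Sum>s\<in>S. \<Sum>j=1..m. (cvec_norm (\<Phi> j s))\<^sup>2)"
    by (rule sum.cong) (use \<Phi> S in \<open>auto simp: designs_def\<close>)
  also have "\<dots> = (\<Sum>j=1..m. \<Sum>s\<in>S. (cvec_norm (\<Phi> j s))\<^sup>2)"
    by (rule sum.swap)
  finally have "(\<Sum>s\<in>S. \<alpha> s) - t * (\<Sum>j=1..m. real (min (card S) (d j))) =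
      (\<Sum>j=1..m. (\<Sum>s\<in>S. (cvec_norm (\<Phi> j s))\<^sup>2) - t * real (min (card S) (d j)))"
    by (simp add: sum_subtractf sum_distrib_left)
  also have "\<dots> \<le> (\<Sum>j=1..m. \<Sum>x\<leftarrow>spectrum_decr (frame_mat (d j) n (\<Phi> j)). max 0 (x - t))"
    by (rule sum_mono, rule frame_spectrum_hinge) (use \<Phi> S t in \<open>auto simp: designs_def\<close>)
  also have "\<dots> = (\<Sum>x\<leftarrow>design_Lambda m n d \<Phi>. max 0 (x - t))"
    unfolding design_Lambda_def design_spectra_def by (rule sum_list_concat_segment[symmetric])
  finally show ?thesis .
qed

section \<open>Multiplicities and majorized segments\<close>

text \<open>The \<open>i\<close>-th term is counted once for every space that has an \<open>i\<close>-th coordinate.\<close>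

lemma h_count_double_counting:
  fixes \<phi> :: "nat \<Rightarrow> real"
  shows "(\<Sum>j=1..m. \<Sum>i<min N (d j). \<phi> i) = (\<Sum>i<N. real (h_count m d (Suc i)) * \<phi> i)"
proof -
  have "(\<Sum>j=1..m. \<Sum>i<min N (d j). \<phi> i) = (\<Sum>j=1..m. \<Sum>i<N. if Suc i \<le> d j then \<phi> i else 0)"
    by (intro sum.cong refl sum.mono_neutral_cong_left) auto
  also have "\<dots> = (\<Sum>i<N. \<Sum>j=1..m. if Suc i \<le> d j then \<phi> i else 0)"
    by (rule sum.swap)
  also have "\<dots> = (\<Sum>i<N. real (h_count m d (Suc i)) * \<phi> i)"
    by (intro sum.cong refl) (simp add: h_count_def sum.If_cases Int_def)
  finally show ?thesis .
qed

lemma h_count_antimono: "i \<le> i' \<Longrightarrow> h_count m d i' \<le> h_count m d i"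
  unfolding h_count_def by (intro card_mono) auto

lemma sum_lessThan_add: "(\<Sum>i<a + b. f i) = (\<Sum>i<a. f i) + (\<Sum>i<b. f (a + i))" for f :: "nat \<Rightarrow> real"
  by (induction b) (auto simp: ac_simps)

lemma nth_segment: "i < Suc t - s \<Longrightarrow> segment x s t ! i = x (s + i)"
  by (simp add: segment_def del: upt_Suc)

lemma length_segment [simp]: "length (segment x s t) = Suc t - s"
  by (simp add: segment_def del: upt_Suc)

text \<open>For sorted families the rearrangement in the definition of majorization disappears. The shorter
  family \<open>y\<close> is assumed to vanish beyond its segment, which absorbs the padding with zeros.\<close>

lemma segment_majorized_partial_sums:
  fixes x y :: "nat \<Rightarrow> real"
  assumes maj: "segment x s t \<prec>\<^sub>m segment y s t'" and t': "t' \<le> t"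
    and x: "\<And>i j. s \<le> i \<Longrightarrow> i \<le> j \<Longrightarrow> j \<le> t \<Longrightarrow> x j \<le> x i"
    and y: "\<And>i j. s \<le> i \<Longrightarrow> i \<le> j \<Longrightarrow> j \<le> t \<Longrightarrow> y j \<le> y i"
    and y0: "\<And>i. t' < i \<Longrightarrow> y i = 0"
  shows "\<And>l. l \<le> Suc t - s \<Longrightarrow> (\<Sum>i<l. x (s + i)) \<le> (\<Sum>i<l. y (s + i))"
    and "(\<Sum>i<Suc t - s. x (s + i)) = (\<Sum>i<Suc t - s. y (s + i))"
proof -
  let ?k = "Suc t - s"
  have sorted: "decr (segment z s t) = segment z s t"
    if "\<And>i j. s \<le> i \<Longrightarrow> i \<le> j \<Longrightarrow> j \<le> t \<Longrightarrow> z j \<le> z i" for z :: "nat \<Rightarrow> real"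
    by (rule decr_eq_self) (auto simp: sorted_wrt_iff_nth_less nth_segment intro!: that)
  have sorted_x: "decr (segment x s t) = segment x s t" by (rule sorted) (rule x)
  have sorted_y: "decr (segment y s t) = segment y s t" by (rule sorted) (rule y)
  have pad: "zero_pad ?k (segment y s t') = segment y s t"
  proof (rule nth_equalityI)
    fix i assume "i < length (zero_pad ?k (segment y s t'))"
    then have "i < ?k" using t' by (auto simp: zero_pad_def)
    then show "zero_pad ?k (segment y s t') ! i = segment y s t ! i"
      using y0 by (auto simp: zero_pad_def nth_append nth_segment)
  qed (use t' in \<open>auto simp: zero_pad_def\<close>)
  have sums: "(\<Sum>i<l. segment z s t ! i) = (\<Sum>i<l. z (s + i))" if "l \<le> ?k" for l and z :: "nat \<Rightarrow> real"
    using that by (intro sum.cong) (auto simp: nth_segment)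
  have "max (length (segment x s t)) (length (segment y s t')) = ?k" using t' by simp
  moreover have "zero_pad ?k (segment x s t) = segment x s t"
    by (simp add: zero_pad_def)
  ultimately have all: "\<forall>l\<in>{1..?k}. (\<Sum>i<l. segment x s t ! i) \<le> (\<Sum>i<l. segment y s t ! i)"
    and tot: "(\<Sum>i<?k. segment x s t ! i) = (\<Sum>i<?k. segment y s t ! i)"
    using maj sorted_x sorted_y unfolding majorized_def Let_def by (auto simp: pad)
  show "(\<Sum>i<l. x (s + i)) \<le> (\<Sum>i<l. y (s + i))" if "l \<le> ?k" for l
    using all[rule_format, of l] that by (cases "l = 0") (auto simp: sums)
  show "(\<Sum>i<?k. x (s + i)) = (\<Sum>i<?k. y (s + i))"
    using tot by (simp only: sums order_refl)
qed

section \<open>The optimal spectra\<close>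

text \<open>The hypotheses on \<open>\<alpha>\<close>, the dimensions and the partition that both parts of the proof share.\<close>

locale optimal_partition =
  fixes m n p :: nat and d g :: "nat \<Rightarrow> nat" and \<alpha> :: "nat \<Rightarrow> real"
  assumes d_le: "j \<in> {1..m} \<Longrightarrow> d j \<le> d 1"
    and \<alpha>_dec: "i \<in> {1..n} \<Longrightarrow> k \<in> {1..n} \<Longrightarrow> i \<le> k \<Longrightarrow> \<alpha> k \<le> \<alpha> i"
    and d1_le: "d 1 \<le> n"
    and partition: "op_partition m n \<alpha> d p g"
begin

abbreviation "h i \<equiv> real (h_count m d i)"
abbreviation "\<gamma> \<equiv> op_gamma m n \<alpha> d p g"
abbreviation "\<mu> \<equiv> op_mu1 m n \<alpha> d p g"

lemma p: "1 \<le> p" and g0: "g 0 = 0" and gp: "g p = d 1"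
  and g_step: "k \<in> {1..p} \<Longrightarrow> g (k - 1) < g k"
  and \<gamma>_step: "k \<in> {1..<p} \<Longrightarrow> \<gamma> (k + 1) < \<gamma> k" and \<gamma>_last: "0 < \<gamma> p"
  and block_maj: "k \<in> {1..<p} \<Longrightarrow> segment \<alpha> (g (k - 1) + 1) (g k)
          \<prec>\<^sub>m segment (\<lambda>i. \<gamma> k * h i) (g (k - 1) + 1) (g k)"
  and last_maj: "segment \<alpha> (g (p - 1) + 1) n \<prec>\<^sub>m segment (\<lambda>i. \<gamma> p * h i) (g (p - 1) + 1) (d 1)"
  using partition unfolding op_partition_def Let_def by auto

lemma g_mono:
  assumes "a \<le> b" "b \<le> p" shows "g a \<le> g b"
  using assms
proof (induction b rule: dec_induct)
  case (step b)
  then show ?case using g_step[of "Suc b"] by simp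
qed simp

lemma \<gamma>_antimono:
  assumes "1 \<le> a" "a \<le> b" "b \<le> p" shows "\<gamma> b \<le> \<gamma> a"
  using assms(2,3)
proof (induction b rule: dec_induct)
  case (step b)
  then show ?case using \<gamma>_step[of b] assms(1) by simp
qed simp

lemma \<gamma>_pos: "1 \<le> k \<Longrightarrow> k \<le> p \<Longrightarrow> 0 < \<gamma> k"
  using \<gamma>_antimono[of k p] \<gamma>_last by simp

lemma block_order:
  assumes "k \<in> {1..p}" "k' \<in> {1..p}" "g (k - 1) < i" "i' \<le> g k'" "i \<le> i'"
  shows "k \<le> k'"
proof (rule ccontr)
  assume "\<not> k \<le> k'"
  then have "g k' \<le> g (k - 1)" using assms by (intro g_mono) auto
  then show False using assms by simp
qed

lemma \<mu>_block:
  assumes k: "k \<in> {1..p}" "g (k - 1) < i" "i \<le> g k"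
  shows "\<mu> i = \<gamma> k"
proof -
  have "(THE k. k \<in> {1..p} \<and> g (k - 1) + 1 \<le> i \<and> i \<le> g k) = k"
  proof (rule the_equality)
    fix k' assume "k' \<in> {1..p} \<and> g (k' - 1) + 1 \<le> i \<and> i \<le> g k'"
    then show "k' = k"
      using block_order[of k k' i i] block_order[of k' k i i] k by auto
  qed (use k in auto)
  then show ?thesis by (simp add: op_mu1_def)
qed

lemma block_exists:
  assumes "1 \<le> i" "i \<le> d 1"
  obtains k where "k \<in> {1..p}" "g (k - 1) < i" "i \<le> g k"
proof -
  define k where "k = (LEAST k. i \<le> g k)"
  have ex: "i \<le> g p" using assms gp by simp
  have "i \<le> g k" unfolding k_def using ex by (rule LeastI)
  moreover have "k \<le> p" unfolding k_def using ex by (rule Least_le)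
  moreover have "k \<noteq> 0" using \<open>i \<le> g k\<close> g0 assms(1) by (metis le_zero_eq not_one_le_zero)
  moreover have "g (k - 1) < i"
    using not_less_Least[of "k - 1" "\<lambda>k. i \<le> g k"] \<open>k \<noteq> 0\<close> unfolding k_def[symmetric] by simp
  ultimately show ?thesis using that[of k] by simp
qed

lemma \<mu>_pos: "1 \<le> i \<Longrightarrow> i \<le> d 1 \<Longrightarrow> 0 < \<mu> i"
  by (elim block_exists) (use \<mu>_block \<gamma>_pos in auto)

lemma \<mu>_antimono:
  assumes "1 \<le> i" "i \<le> i'" "i' \<le> d 1"
  shows "\<mu> i' \<le> \<mu> i"
proof -
  obtain k where k: "k \<in> {1..p}" "g (k - 1) < i" "i \<le> g k"
    using assms by (meson block_exists order.trans)
  obtain k' where k': "k' \<in> {1..p}" "g (k' - 1) < i'" "i' \<le> g k'"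
    using assms by (meson block_exists order.trans)
  have "k \<le> k'" using block_order k k' assms by blast
  then show ?thesis using \<mu>_block[OF k] \<mu>_block[OF k'] \<gamma>_antimono[of k k'] k k' by simp
qed

lemma h_beyond:
  assumes "d 1 < i" shows "h_count m d i = 0"
proof -
  have "\<not> i \<le> d j" if "j \<in> {1..m}" for j using d_le[OF that] assms by simp
  then have "{j \<in> {1..m}. i \<le> d j} = {}" by blast
  then show ?thesis by (simp only: h_count_def card.empty)
qed

text \<open>The products \<open>\<mu>\<^sub>i h\<^sub>i\<close> vanish beyond \<open>d\<^sub>1\<close>, whatever value \<open>\<mu>\<^sub>i\<close> takes there, so they form a sorted family
  of arbitrary length that is already padded with zeros.\<close>

lemma weighted_antimono:
  assumes "1 \<le> i" "i \<le> i'"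
  shows "\<mu> i' * h i' \<le> \<mu> i * h i"
proof (cases "i' \<le> d 1")
  case True
  then show ?thesis using assms
    by (intro mult_mono \<mu>_antimono) (auto intro: h_count_antimono less_imp_le[OF \<mu>_pos])
next
  case False
  then have "\<mu> i' * h i' = 0" using h_beyond by simp
  moreover have "0 \<le> \<mu> i * h i"
    using \<mu>_pos[of i] h_beyond[of i] assms by (cases "i \<le> d 1") auto
  ultimately show ?thesis by (simp only:)
qed

lemma block_sums:
  assumes k: "k \<in> {1..<p}"
  shows "l \<le> g k - g (k - 1) \<Longrightarrow>
      (\<Sum>i<l. \<alpha> (Suc (g (k - 1) + i))) \<le> (\<Sum>i<l. \<mu> (Suc (g (k - 1) + i)) * h (Suc (g (k - 1) + i)))"
    and "(\<Sum>i<g k - g (k - 1). \<alpha> (Suc (g (k - 1) + i))) =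
      (\<Sum>i<g k - g (k - 1). \<mu> (Suc (g (k - 1) + i)) * h (Suc (g (k - 1) + i)))"
proof -
  let ?G = "g (k - 1)"
  have k1: "k \<in> {1..p}" using k by simp
  have gk: "?G < g k" "g k \<le> n" using g_step[OF k1] g_mono[of k p] gp d1_le k by auto
  \<comment> \<open>\<open>h\<close> need not vanish beyond the block, so the majorizing family is cut off there.\<close>
  have seg: "segment (\<lambda>i. \<gamma> k * h i) (?G + 1) (g k) = segment (\<lambda>i. if i \<le> g k then \<gamma> k * h i else 0) (?G + 1) (g k)"
    by (auto simp: segment_def simp del: upt_Suc)
  note * = segment_majorized_partial_sums[OF block_maj[OF k, unfolded seg] order_refl]
  have \<mu>h: "\<mu> (Suc (?G + i)) * h (Suc (?G + i)) = (if ?G + 1 + i \<le> g k then \<gamma> k * h (?G + 1 + i) else 0)"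
    if "i < g k - ?G" for i
    using \<mu>_block[OF k1, of "Suc (?G + i)"] that by simp
  have prems: "\<And>i j. ?G + 1 \<le> i \<Longrightarrow> i \<le> j \<Longrightarrow> j \<le> g k \<Longrightarrow> \<alpha> j \<le> \<alpha> i"
      "\<And>i j. ?G + 1 \<le> i \<Longrightarrow> i \<le> j \<Longrightarrow> j \<le> g k \<Longrightarrow>
        (if j \<le> g k then \<gamma> k * h j else 0) \<le> (if i \<le> g k then \<gamma> k * h i else 0)"
      "\<And>i. g k < i \<Longrightarrow> (if i \<le> g k then \<gamma> k * h i else 0) = 0"
    using gk \<alpha>_dec \<gamma>_pos[of k] k by (auto intro!: mult_left_mono h_count_antimono)
  show "(\<Sum>i<l. \<alpha> (Suc (?G + i))) \<le> (\<Sum>i<l. \<mu> (Suc (?G + i)) * h (Suc (?G + i)))" if l: "l \<le> g k - ?G"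
  proof -
    have "(\<Sum>i<l. \<alpha> (Suc (?G + i))) \<le> (\<Sum>i<l. if ?G + 1 + i \<le> g k then \<gamma> k * h (?G + 1 + i) else 0)"
      using *(1)[OF prems, of l] l by simp
    also have "\<dots> = (\<Sum>i<l. \<mu> (Suc (?G + i)) * h (Suc (?G + i)))"
      by (rule sum.cong) (use \<mu>h l in auto)
    finally show ?thesis .
  qed
  have "(\<Sum>i<g k - ?G. \<alpha> (Suc (?G + i))) = (\<Sum>i<g k - ?G. if ?G + 1 + i \<le> g k then \<gamma> k * h (?G + 1 + i) else 0)"
    using *(2)[OF prems] by simp
  also have "\<dots> = (\<Sum>i<g k - ?G. \<mu> (Suc (?G + i)) * h (Suc (?G + i)))"
    by (rule sum.cong) (use \<mu>h in auto)
  finally show "(\<Sum>i<g k - ?G. \<alpha> (Suc (?G + i))) = (\<Sum>i<g k - ?G. \<mu> (Suc (?G + i)) * h (Suc (?G + i)))" .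
qed

lemma last_block_sums:
  defines "G \<equiv> g (p - 1)"
  shows "l \<le> n - G \<Longrightarrow> (\<Sum>i<l. \<alpha> (Suc (G + i))) \<le> (\<Sum>i<l. \<mu> (Suc (G + i)) * h (Suc (G + i)))"
    and "(\<Sum>i<n - G. \<alpha> (Suc (G + i))) = (\<Sum>i<n - G. \<mu> (Suc (G + i)) * h (Suc (G + i)))"
proof -
  have G: "G < d 1" using g_step[of p] p gp by (simp add: G_def)
  have prems: "d 1 \<le> n"
      "\<And>i j. G + 1 \<le> i \<Longrightarrow> i \<le> j \<Longrightarrow> j \<le> n \<Longrightarrow> \<alpha> j \<le> \<alpha> i"
      "\<And>i j. G + 1 \<le> i \<Longrightarrow> i \<le> j \<Longrightarrow> j \<le> n \<Longrightarrow> \<gamma> p * h j \<le> \<gamma> p * h i"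
      "\<And>i. d 1 < i \<Longrightarrow> \<gamma> p * h i = 0"
    using G d1_le \<alpha>_dec \<gamma>_last h_beyond by (auto intro!: mult_left_mono h_count_antimono)
  note * = segment_majorized_partial_sums[OF last_maj[folded G_def] prems]
  have \<mu>h: "\<mu> (Suc (G + i)) * h (Suc (G + i)) = \<gamma> p * h (G + 1 + i)" for i
    using \<mu>_block[of p "Suc (G + i)"] p gp h_beyond[of "Suc (G + i)"]
    by (cases "Suc (G + i) \<le> d 1") (auto simp: G_def)
  show "(\<Sum>i<l. \<alpha> (Suc (G + i))) \<le> (\<Sum>i<l. \<mu> (Suc (G + i)) * h (Suc (G + i)))" if "l \<le> n - G"
    unfolding \<mu>h using *(1)[of l] that by simp
  show "(\<Sum>i<n - G. \<alpha> (Suc (G + i))) = (\<Sum>i<n - G. \<mu> (Suc (G + i)) * h (Suc (G + i)))"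
    unfolding \<mu>h using *(2) by simp
qed

lemma sum_up_to_block:
  assumes "r < p"
  shows "(\<Sum>i<g r. \<alpha> (Suc i)) = (\<Sum>i<g r. \<mu> (Suc i) * h (Suc i))"
  using assms
proof (induction r)
  case (Suc r)
  have "g (Suc r) = g r + (g (Suc r) - g r)" using g_step[of "Suc r"] Suc.prems by simp
  then show ?case
    using Suc block_sums(2)[of "Suc r"]
      sum_lessThan_add[where f = "\<lambda>i. \<alpha> (Suc i)" and a = "g r" and b = "g (Suc r) - g r"]
      sum_lessThan_add[where f = "\<lambda>i. \<mu> (Suc i) * h (Suc i)" and a = "g r" and b = "g (Suc r) - g r"]
    by simp
qed (simp add: g0)

lemma sum_total: "(\<Sum>i<n. \<alpha> (Suc i)) = (\<Sum>i<n. \<mu> (Suc i) * h (Suc i))"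
proof -
  let ?G = "g (p - 1)"
  have "?G \<le> n" using g_mono[of "p - 1" p] gp d1_le by simp
  then have "n = ?G + (n - ?G)" by simp
  then show ?thesis
    using sum_up_to_block[of "p - 1"] p last_block_sums(2)
      sum_lessThan_add[where f = "\<lambda>i. \<alpha> (Suc i)" and a = ?G and b = "n - ?G"]
      sum_lessThan_add[where f = "\<lambda>i. \<mu> (Suc i) * h (Suc i)" and a = ?G and b = "n - ?G"]
    by simp
qed

text \<open>The blocks before the one that contains \<open>l\<close> contribute equal sums, and inside that block the majorization
  applies. Since both families are sorted, this is the majorization that Horn's theorem requires.\<close>

lemma sum_partial:
  assumes l: "l \<le> n"
  shows "(\<Sum>i<l. \<alpha> (Suc i)) \<le> (\<Sum>i<l. \<mu> (Suc i) * h (Suc i))"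
proof -
  define r where "r = Max {r. r < p \<and> g r \<le> l}"
  have fin: "finite {r. r < p \<and> g r \<le> l}" by simp
  have "r \<in> {r. r < p \<and> g r \<le> l}"
    unfolding r_def by (rule Max_in[OF fin]) (use p g0 in \<open>auto intro!: exI[of _ 0]\<close>)
  then have r: "r < p" "g r \<le> l" by auto
  have r_max: "r' \<le> r" if "r' < p" "g r' \<le> l" for r'
    unfolding r_def by (rule Max_ge[OF fin]) (use that in simp)
  have "(\<Sum>i<l - g r. \<alpha> (Suc (g r + i))) \<le> (\<Sum>i<l - g r. \<mu> (Suc (g r + i)) * h (Suc (g r + i)))"
  proof (cases "Suc r = p")
    case True
    then have "p - 1 = r" by simp
    then show ?thesis using last_block_sums(1)[of "l - g r"] l by simp
  next
    case False
    then have "Suc r < p" using r by simp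
    moreover have "\<not> g (Suc r) \<le> l" using r_max[of "Suc r"] \<open>Suc r < p\<close> by auto
    ultimately show ?thesis using block_sums(1)[of "Suc r" "l - g r"] by simp
  qed
  then show ?thesis
    using sum_up_to_block[OF r(1)] r(2)
      sum_lessThan_add[where f = "\<lambda>i. \<alpha> (Suc i)" and a = "g r" and b = "l - g r"]
      sum_lessThan_add[where f = "\<lambda>i. \<mu> (Suc i) * h (Suc i)" and a = "g r" and b = "l - g r"]
    by simp
qed


lemma sum_list_op_mu: "sum_list (map f (op_mu m n \<alpha> d p g j)) = (\<Sum>i<d j. f (\<mu> (Suc i)))"
  for f :: "real \<Rightarrow> real"
  unfolding op_mu_def segment_def
  by (simp add: interv_sum_list_conv_sum_set_nat atLeastLessThanSuc_atLeastAtMost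
      sum.atLeast1_atMost_eq o_def del: upt_Suc)

lemma length_op_mu: "length (op_mu m n \<alpha> d p g j) = d j"
  by (simp add: op_mu_def)

lemma sorted_op_mu: "j \<in> {1..m} \<Longrightarrow> sorted_wrt (\<ge>) (op_mu m n \<alpha> d p g j)"
  using d_le[of j] unfolding op_mu_def
  by (auto simp: sorted_wrt_iff_nth_less nth_segment intro!: \<mu>_antimono)

lemma op_mu_nonneg:
  assumes "j \<in> {1..m}" "x \<in> set (op_mu m n \<alpha> d p g j)" shows "0 \<le> x"
proof -
  obtain i where "1 \<le> i" "i \<le> d j" "x = \<mu> i"
    using assms(2) by (auto simp: op_mu_def segment_def less_Suc_eq_le simp del: upt_Suc)
  then show ?thesis using \<mu>_pos[of i] d_le[OF assms(1)] by simp
qed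

text \<open>The vector \<open>f\<^sub>s\<^sub>j\<close> consists of the first \<open>d\<^sub>j\<close> entries of the \<open>s\<close>-th row of \<open>U diag(\<surd>\<mu>)\<close>, so the rows of
  one orthogonal matrix produce the frames in all spaces.\<close>

theorem optimal_design_exists:
  "\<exists>\<Phi>\<in>designs m n \<alpha> d. \<forall>j\<in>{1..m}.
     spectrum_decr (frame_mat (d j) n (\<Phi> j)) = op_mu m n \<alpha> d p g j"
proof -
  have "\<exists>U :: nat \<Rightarrow> nat \<Rightarrow> real.
      (\<forall>i<n. \<forall>j<n. (\<Sum>a<n. U a i * U a j) = (if i = j then 1 else 0)) \<and>
      (\<forall>a<n. (\<Sum>i<n. (U a i)\<^sup>2 * (\<mu> (Suc i) * h (Suc i))) = \<alpha> (Suc a))"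
    by (rule horn_orthogonal) (auto intro: \<alpha>_dec weighted_antimono sum_partial sum_total)
  then obtain U :: "nat \<Rightarrow> nat \<Rightarrow> real" where
    orth: "\<And>i j. i < n \<Longrightarrow> j < n \<Longrightarrow> (\<Sum>a<n. U a i * U a j) = (if i = j then 1 else 0)"
    and diag: "\<And>a. a < n \<Longrightarrow> (\<Sum>i<n. (U a i)\<^sup>2 * (\<mu> (Suc i) * h (Suc i))) = \<alpha> (Suc a)"
    by blast
  define \<Phi> where "\<Phi> j s = vec (d j) (\<lambda>i. complex_of_real (sqrt (\<mu> (Suc i)) * U (s - 1) i))" for j s
  have carr: "\<Phi> j s \<in> carrier_vec (d j)" for j s by (simp add: \<Phi>_def)
  have \<mu>0: "0 \<le> \<mu> (Suc i)" if "j \<in> {1..m}" "i < d j" for i j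
    using \<mu>_pos[of "Suc i"] d_le[OF that(1)] that(2) by simp
  have "\<Phi> \<in> designs m n \<alpha> d"
    unfolding designs_def
  proof (intro CollectI conjI ballI carr)
    fix s assume s: "s \<in> {1..n}"
    have "(\<Sum>j=1..m. (cvec_norm (\<Phi> j s))\<^sup>2) = (\<Sum>j=1..m. \<Sum>i<min n (d j). \<mu> (Suc i) * (U (s - 1) i)\<^sup>2)"
    proof (rule sum.cong)
      fix j assume j: "j \<in> {1..m}"
      then have "min n (d j) = d j" using d_le[OF j] d1_le by simp
      then show "(cvec_norm (\<Phi> j s))\<^sup>2 = (\<Sum>i<min n (d j). \<mu> (Suc i) * (U (s - 1) i)\<^sup>2)"
        unfolding cvec_norm_sq[OF carr] using \<mu>0[OF j]
        by (auto simp: \<Phi>_def norm_mult power_mult_distrib abs_mult intro!: sum.cong)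
    qed simp
    also have "\<dots> = (\<Sum>i<n. h (Suc i) * (\<mu> (Suc i) * (U (s - 1) i)\<^sup>2))"
      by (rule h_count_double_counting)
    also have "\<dots> = \<alpha> s"
      using diag[of "s - 1"] s by (cases s) (simp_all add: mult_ac)
    finally show "(\<Sum>j=1..m. (cvec_norm (\<Phi> j s))\<^sup>2) = \<alpha> s" .
  qed
  moreover have "spectrum_decr (frame_mat (d j) n (\<Phi> j)) = op_mu m n \<alpha> d p g j" if j: "j \<in> {1..m}" for j
  proof -
    let ?A = "frame_mat (d j) n (\<Phi> j)"
    have A: "?A $$ (a, b) = (if a = b then complex_of_real (\<mu> (Suc a)) else 0)" if ab: "a < d j" "b < d j" for a b
    proof -
      have abn: "a < n" "b < n" using ab d_le[OF j] d1_le by auto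
      have "?A $$ (a, b) = (\<Sum>s=1..n. complex_of_real (sqrt (\<mu> (Suc a)) * sqrt (\<mu> (Suc b)) * (U (s - 1) a * U (s - 1) b)))"
        unfolding frame_mat_index[OF carr ab] using ab by (intro sum.cong) (simp_all add: \<Phi>_def mult_ac)
      also have "\<dots> = complex_of_real (sqrt (\<mu> (Suc a)) * sqrt (\<mu> (Suc b)) * (\<Sum>s<n. U s a * U s b))"
        by (simp add: sum.atLeast1_atMost_eq sum_distrib_left)
      also have "\<dots> = (if a = b then complex_of_real (\<mu> (Suc a)) else 0)"
        using orth[OF abn] \<mu>0[OF j ab(1)] by (cases "a = b") (simp_all flip: of_real_mult)
      finally show ?thesis .
    qed
    have "mset (spectrum_decr ?A) = image_mset (\<lambda>i. Re (?A $$ (i, i))) (mset [0..<d j])"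
      by (rule mset_spectrum_decr_upper_triangular[OF frame_mat_carrier])
        (auto simp: upper_triangular_def frame_mat_def[THEN arg_cong[where f = dim_row]] A)
    also have "\<dots> = image_mset (\<lambda>i. \<mu> (Suc i)) (mset [0..<d j])"
      by (rule image_mset_cong) (simp add: A)
    also have "\<dots> = mset (map \<mu> (map Suc [0..<d j]))" by (simp add: multiset.map_comp o_def)
    also have "map Suc [0..<d j] = [1..<Suc (d j)]" by (simp add: map_Suc_upt del: upt_Suc)
    finally have "mset (rev (spectrum_decr ?A)) = mset (rev (op_mu m n \<alpha> d p g j))"
      by (simp add: op_mu_def segment_def del: upt_Suc)
    moreover have "sorted (rev (spectrum_decr ?A))" "sorted (rev (op_mu m n \<alpha> d p g j))"
      using sorted_spectrum_decr sorted_op_mu[OF j] by (auto simp: sorted_wrt_rev)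
    ultimately have "rev (spectrum_decr ?A) = rev (op_mu m n \<alpha> d p g j)"
      by (metis properties_for_sort)
    then show ?thesis by simp
  qed
  ultimately show ?thesis by blast
qed

text \<open>For a threshold \<open>t\<close>, only the blocks with \<open>\<gamma>\<^sub>k > t\<close> contribute to the hinge sum of the optimal spectra,
  and on them the sum of the \<open>\<mu>\<^sub>i h\<^sub>i\<close> equals the sum of the \<open>\<alpha>\<^sub>i\<close>. The last block is exceptional, because it is paired
  with all remaining \<open>\<alpha>\<^sub>i\<close>, of which there may be more than its length; if it contributes, then all
  blocks do and the totals decide.\<close>

theorem optimal_spectra_majorized:
  assumes \<Phi>op: "\<Phi>op \<in> designs m n \<alpha> d"
    and spectra: "design_spectra m n d \<Phi>op = segment (op_mu m n \<alpha> d p g) 1 m"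
    and \<Phi>: "\<Phi> \<in> designs m n \<alpha> d"
  shows "design_Lambda m n d \<Phi>op \<prec>\<^sub>m design_Lambda m n d \<Phi>"
proof (rule majorized_if_hinge_le)
  let ?op = "design_Lambda m n d \<Phi>op" and ?L = "design_Lambda m n d \<Phi>"
  show len: "length ?op = length ?L"
    using design_Lambda_length[OF \<Phi>op] design_Lambda_length[OF \<Phi>] by simp
  show tot: "sum_list ?op = sum_list ?L"
    using design_Lambda_sum[OF \<Phi>op] design_Lambda_sum[OF \<Phi>] by simp
  fix t :: real
  have "(\<Sum>x\<leftarrow>?op. max 0 (x - t)) = (\<Sum>j=1..m. \<Sum>x\<leftarrow>op_mu m n \<alpha> d p g j. max 0 (x - t))"
    unfolding design_Lambda_def spectra by (rule sum_list_concat_segment)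
  also have "\<dots> = (\<Sum>j=1..m. \<Sum>i<min (d 1) (d j). max 0 (\<mu> (Suc i) - t))"
    using d_le by (intro sum.cong) (auto simp: sum_list_op_mu min_absorb2)
  also have "\<dots> = (\<Sum>i<d 1. h (Suc i) * max 0 (\<mu> (Suc i) - t))"
    by (rule h_count_double_counting)
  finally have hinge_op: "(\<Sum>x\<leftarrow>?op. max 0 (x - t)) = (\<Sum>i<d 1. h (Suc i) * max 0 (\<mu> (Suc i) - t))" .
  show "(\<Sum>x\<leftarrow>?op. max 0 (x - t)) \<le> (\<Sum>x\<leftarrow>?L. max 0 (x - t))"
  proof (cases "t < \<gamma> p")
    case True
    have t_less: "t < \<mu> (Suc i)" if i: "i < d 1" for i
    proof -
      obtain k where k: "k \<in> {1..p}" "g (k - 1) < Suc i" "Suc i \<le> g k"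
        using block_exists[of "Suc i"] i by auto
      then show ?thesis using True \<mu>_block[OF k] \<gamma>_antimono[of k p] by simp
    qed
    have op_mem: "t \<le> x" if "x \<in> set ?op" for x
    proof -
      obtain j where j: "j \<in> {1..m}" and x: "x \<in> set (op_mu m n \<alpha> d p g j)"
        using \<open>x \<in> set ?op\<close> unfolding design_Lambda_def spectra
        by (auto simp: segment_def less_Suc_eq_le simp del: upt_Suc)
      from x obtain i where "i < d j" "x = \<mu> (Suc i)"
        by (auto simp: op_mu_def in_set_conv_nth nth_segment)
      then show ?thesis using t_less[of i] d_le[OF j] by simp
    qed
    have "(\<Sum>x\<leftarrow>?op. max 0 (x - t)) = (\<Sum>x\<leftarrow>?op. x - t)"
      using op_mem by (intro arg_cong[of _ _ sum_list] map_cong) auto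
    also have "\<dots> = (\<Sum>x\<leftarrow>?L. x - t)"
      using tot len by (simp add: sum_list_subtractf sum_list_triv)
    also have "\<dots> \<le> (\<Sum>x\<leftarrow>?L. max 0 (x - t))"
      by (rule sum_list_mono) simp
    finally show ?thesis .
  next
    case False
    then have t0: "0 \<le> t" using \<gamma>_last by simp
    \<comment> \<open>\<open>r\<close> is the number of blocks whose value exceeds \<open>t\<close>.\<close>
    define r where "r = (LEAST r. \<gamma> (Suc r) \<le> t)"
    have ex: "\<gamma> (Suc (p - 1)) \<le> t" using False p by simp
    have r: "\<gamma> (Suc r) \<le> t" unfolding r_def using ex by (rule LeastI)
    have "r \<le> p - 1" unfolding r_def using ex by (rule Least_le)
    then have rp: "r < p" using p by simp
    have before: "t < \<gamma> (Suc k)" if "k < r" for k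
      using not_less_Least[of k "\<lambda>r. \<gamma> (Suc r) \<le> t"] that unfolding r_def[symmetric] by simp
    have gr: "g r \<le> d 1" using g_mono[of r p] rp gp by simp
    have hinge: "max 0 (\<mu> (Suc i) - t) = (if i < g r then \<mu> (Suc i) - t else 0)" if i: "i < d 1" for i
    proof -
      obtain k where k: "k \<in> {1..p}" "g (k - 1) < Suc i" "Suc i \<le> g k"
        using block_exists[of "Suc i"] i by auto
      show ?thesis
      proof (cases "k \<le> r")
        case True
        then have "i < g r" using g_mono[of k r] k rp by simp
        moreover have "k - 1 < r" "Suc (k - 1) = k" using True k by auto
        then have "t < \<gamma> k" using before[of "k - 1"] by simp
        ultimately show ?thesis using \<mu>_block[OF k] by simp
      next
        case False
        then have "g r \<le> g (k - 1)" using g_mono[of r "k - 1"] k by simp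
        moreover have "\<gamma> k \<le> \<gamma> (Suc r)" using \<gamma>_antimono[of "Suc r" k] False k by simp
        ultimately show ?thesis using k r \<mu>_block[OF k] by simp
      qed
    qed
    have "(\<Sum>x\<leftarrow>?op. max 0 (x - t)) = (\<Sum>i<d 1. if i < g r then h (Suc i) * (\<mu> (Suc i) - t) else 0)"
      unfolding hinge_op by (rule sum.cong) (auto simp: hinge)
    also have "\<dots> = (\<Sum>i<g r. h (Suc i) * (\<mu> (Suc i) - t))"
      by (rule sum.mono_neutral_cong_right) (use gr in auto)
    also have "\<dots> = (\<Sum>i<g r. \<mu> (Suc i) * h (Suc i)) - t * (\<Sum>i<g r. h (Suc i))"
      by (simp add: algebra_simps sum_subtractf sum_distrib_left)
    also have "(\<Sum>i<g r. \<mu> (Suc i) * h (Suc i)) = (\<Sum>s\<in>{1..g r}. \<alpha> s)"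
      using sum_up_to_block[OF rp] by (simp add: sum.atLeast1_atMost_eq)
    also have "(\<Sum>i<g r. h (Suc i)) = (\<Sum>j=1..m. real (min (card {1..g r}) (d j)))"
      using h_count_double_counting[where \<phi> = "\<lambda>_. 1" and N = "g r" and m = m and d = d] by simp
    also have "(\<Sum>s\<in>{1..g r}. \<alpha> s) - t * \<dots> \<le> (\<Sum>x\<leftarrow>?L. max 0 (x - t))"
      by (rule design_Lambda_hinge[OF \<Phi> t0]) (use gr d1_le in auto)
    finally show ?thesis .
  qed
qed

end

theorem theorem3p14:
  fixes m n p :: nat and d g :: "nat \<Rightarrow> nat" and \<alpha> :: "nat \<Rightarrow> real"
  assumes "1 \<le> m" and "1 \<le> n"
    and "\<forall>j\<in>{1..m}. 1 \<le> d j"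
    and "\<forall>i\<in>{1..m}. \<forall>j\<in>{1..m}. i \<le> j \<longrightarrow> d j \<le> d i"
    and "\<forall>i\<in>{1..n}. 0 < \<alpha> i"
    and "\<forall>i\<in>{1..n}. \<forall>k\<in>{1..n}. i \<le> k \<longrightarrow> \<alpha> k \<le> \<alpha> i"
    and "d 1 \<le> n"
    and "op_partition m n \<alpha> d p g"
  shows "admissible m n \<alpha> d (op_mu m n \<alpha> d p g) \<and>
    (\<exists>\<Phi>op\<in>designs m n \<alpha> d.
       design_spectra m n d \<Phi>op = segment (op_mu m n \<alpha> d p g) 1 m \<and>
       (\<forall>j\<in>{1..m}. spectrum_decr (frame_mat (d j) n (\<Phi>op j)) = op_mu m n \<alpha> d p g j)) \<and>
    (\<forall>\<Phi>op\<in>designs m n \<alpha> d.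
       design_spectra m n d \<Phi>op = segment (op_mu m n \<alpha> d p g) 1 m \<longrightarrow>
       (\<forall>\<Phi>\<in>designs m n \<alpha> d. design_Lambda m n d \<Phi>op \<prec>\<^sub>m design_Lambda m n d \<Phi>))"
proof -
  interpret optimal_partition m n p d g \<alpha>
    by unfold_locales (use assms in auto)
  obtain \<Phi> where \<Phi>: "\<Phi> \<in> designs m n \<alpha> d"
    and spec: "\<forall>j\<in>{1..m}. spectrum_decr (frame_mat (d j) n (\<Phi> j)) = op_mu m n \<alpha> d p g j"
    using optimal_design_exists by blast
  have spectra: "design_spectra m n d \<Phi> = segment (op_mu m n \<alpha> d p g) 1 m"
    unfolding design_spectra_def segment_def
    by (rule map_cong) (use spec in auto)
  have "admissible m n \<alpha> d (op_mu m n \<alpha> d p g)"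
    unfolding admissible_def using length_op_mu sorted_op_mu op_mu_nonneg \<Phi> spectra by blast
  then show ?thesis
    using \<Phi> spec spectra optimal_spectra_majorized by blast
qed

end
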